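(* Let $\mathcal{X},\mathcal{Y}\subset\mathbf{E}$ be two sets in a Euclidean space $\mathbf{E}$ that are definable in an o-minimal structure, and let $\bar x\in\mathcal{Y}$. Suppose in addition that $\mathcal{Y}$ is a $C^2$-smooth manifold around $\bar x$ and that $\mathcal{X}$ is a locally closed set. If $\mathcal{X}$ is strongly $(a)$-regular along $\mathcal{Y}$ near $\bar x$, then $\mathcal{X}$ is $(b_=)$-regular along $\mathcal{Y}$ near $\bar x$.
   Context: $\mathbf{B}$ is the closed unit ball. The Fréchet normal cone $\hat N_Q(x)$ to $Q$ at $x\in Q$ is the set of $v$ with $\langle v,y-x\rangle\le o(\|y-x\|)$ as $y\to x$ in $Q$; the limiting normal cone $N_Q(x)$ consists of limits of $v_i\in\hat N_Q(x_i)$ with $x_i\to x$ in $Q$. For closed cones $U,V$ set $\Delta(U,V)=\sup\{\mathrm{dist}(u,V):u\in U,\|u\|=1\}$. $\mathcal{X}$ is strongly $(a)$-regular along $\mathcal{Y}$ if there is $C>0$ with $\Delta(N_{\mathcal{X}}(x),N_{\mathcal{Y}}(y))\le C\|x-y\|$ for all $x\in\mathcal{X}$, $y\in\mathcal{Y}$. $\mathcal{X}$ is $(b_=)$-regular along $\mathcal{Y}$ if $\langle v,y-x\rangle=o(\|y-x\|)$ for all $x\in\mathcal{X}$, $y\in\mathcal{Y}$, $v\in N_{\mathcal{X}}(x)\cap\mathbf{B}$ (equivalently, for sequences $x_i\in\mathcal{X}$, $y_i\in\mathcal{Y}$, $x_i\neq y_i$, converging to the same point and unit $v_i\in N_{\mathcal{X}}(x_i)$,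 one has $\langle v_i,(y_i-x_i)/\|y_i-x_i\|\rangle\to0$). Either property holds near $\bar x\in\mathcal{Y}$ if it holds for $\mathcal{X}\cap U$ along $\mathcal{Y}\cap U$ for some neighborhood $U$ of $\bar x$. *)

theory Defs
  imports "HOL-Analysis.Analysis"
begin

section \<open>O-minimal structures and definable sets\<close>

text \<open>
  Points of \<open>R^n\<close> are represented by real lists of length \<open>n\<close>, so that \<open>n\<close> can vary inside a
  formula. Functions are used only on lists of that length.
\<close>

definition Rn :: "nat \<Rightarrow> real list set" where
  "Rn n = {xs. length xs = n}"

inductive polynomial_fun :: "nat \<Rightarrow> (real list \<Rightarrow> real) \<Rightarrow> bool" for n where
  const: "polynomial_fun n (\<lambda>xs. c)"
| coord: "i < n \<Longrightarrow> polynomial_fun n (\<lambda>xs. xs ! i)"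
| add: "polynomial_fun n p \<Longrightarrow> polynomial_fun n q \<Longrightarrow> polynomial_fun n (\<lambda>xs. p xs + q xs)"
| mult: "polynomial_fun n p \<Longrightarrow> polynomial_fun n q \<Longrightarrow> polynomial_fun n (\<lambda>xs. p xs * q xs)"

text \<open>
  O-minimal structures here expand the ordered field of real numbers (axiom \<open>zero_sets\<close>).
  In the last axiom \<^const>\<open>is_interval\<close> means order-convex: bounded or unbounded, with or without
  end points, possibly a single point.
\<close>

locale o_minimal_structure =
  fixes D :: "nat \<Rightarrow> real list set set"
  assumes subset_Rn: "A \<in> D n \<Longrightarrow> A \<subseteq> Rn n"
    and Rn_mem: "Rn n \<in> D n"
    and union: "A \<in> D n \<Longrightarrow> B \<in> D n \<Longrightarrow> A \<union> B \<in> D n"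
    and complement: "A \<in> D n \<Longrightarrow> Rn n - A \<in> D n"
    and times_R: "A \<in> D n \<Longrightarrow> {xs @ [t] | xs t. xs \<in> A} \<in> D (Suc n)"
    and R_times: "A \<in> D n \<Longrightarrow> {t # xs | xs t. xs \<in> A} \<in> D (Suc n)"
    and projection: "A \<in> D (Suc n) \<Longrightarrow> butlast ` A \<in> D n"
    and zero_sets: "polynomial_fun n p \<Longrightarrow> {xs \<in> Rn n. p xs = 0} \<in> D n"
    and line: "D 1 = {(\<lambda>t. [t]) ` \<Union>\<I> | \<I>. finite \<I> \<and> (\<forall>I\<in>\<I>. is_interval (I :: real set))}"

text \<open>
  A subset of a Euclidean space is definable if its set of coordinate vectors is. The standard
  basis carries no order; the order chosen is immaterial, because the axioms make
  each \<open>D n\<close> invariant under permutations of the coordinates.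
\<close>

definition definable :: "(nat \<Rightarrow> real list set set) \<Rightarrow> 'a::euclidean_space set \<Rightarrow> bool" where
  "definable D S \<longleftrightarrow>
     (\<exists>bs. distinct bs \<and> set bs = (Basis :: 'a set) \<and>
           (\<lambda>x. map (\<lambda>b. x \<bullet> b) bs) ` S \<in> D DIM('a))"


section \<open>Smooth manifolds\<close>

definition C2_smooth_on ::
  "'a::real_normed_vector set \<Rightarrow> ('a \<Rightarrow> 'b::real_normed_vector) \<Rightarrow> bool" where
  "C2_smooth_on U F \<longleftrightarrow>
     (\<exists>(F' :: 'a \<Rightarrow> 'a \<Rightarrow>\<^sub>L 'b) (F'' :: 'a \<Rightarrow> 'a \<Rightarrow>\<^sub>L 'a \<Rightarrow>\<^sub>L 'b).
        (\<forall>x\<in>U. (F has_derivative blinfun_apply (F' x)) (at x)) \<and>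
        (\<forall>x\<in>U. (F' has_derivative blinfun_apply (F'' x)) (at x)) \<and>
        continuous_on U F'')"

text \<open>
  Near \<open>x\<close> the set \<open>M\<close> is the zero set of a \<open>C\<^sup>2\<close> submersion \<open>F : U \<rightarrow> R^m\<close>. As \<open>m\<close> may be any
  number from \<open>0\<close> to the dimension of the ambient space, a linear subspace \<open>V\<close> of that space
  plays the role of \<open>R^m\<close>.
\<close>

definition C2_manifold_around :: "'a::euclidean_space set \<Rightarrow> 'a \<Rightarrow> bool" where
  "C2_manifold_around M x \<longleftrightarrow>
     x \<in> M \<and>
     (\<exists>(U :: 'a set) (V :: 'a set) (F :: 'a \<Rightarrow> 'a).
        open U \<and> x \<in> U \<and> subspace V \<and> F ` U \<subseteq> V \<and> C2_smooth_on U F \<and>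
        (\<forall>y\<in>U. range (frechet_derivative F (at y)) = V) \<and>
        M \<inter> U = {y \<in> U. F y = 0})"


section \<open>Normal cones\<close>

definition frechet_normal_cone :: "'a::euclidean_space set \<Rightarrow> 'a \<Rightarrow> 'a set" where
  "frechet_normal_cone Q x =
     {v. \<forall>\<epsilon>>0. \<forall>\<^sub>F y in at x within Q. v \<bullet> (y - x) \<le> \<epsilon> * norm (y - x)}"

definition limiting_normal_cone :: "'a::euclidean_space set \<Rightarrow> 'a \<Rightarrow> 'a set" where
  "limiting_normal_cone Q x =
     {v. \<exists>xs vs. (\<forall>i::nat. xs i \<in> Q \<and> vs i \<in> frechet_normal_cone Q (xs i)) \<and>
                 xs \<longlonglongrightarrow> x \<and> vs \<longlonglongrightarrow> v}"

text \<open>The supremum is taken in \<open>[0, \<infinity>)\<close>: it is \<open>0\<close> if \<open>U\<close> contains no unit vector.\<close>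

definition cone_gap :: "'a::euclidean_space set \<Rightarrow> 'a set \<Rightarrow> real" where
  "cone_gap U V =
     (if \<exists>u\<in>U. norm u = 1 then (SUP u \<in> {u \<in> U. norm u = 1}. infdist u V) else 0)"


section \<open>Regularity conditions\<close>

definition strongly_a_regular :: "'a::euclidean_space set \<Rightarrow> 'a set \<Rightarrow> bool" where
  "strongly_a_regular X Y \<longleftrightarrow>
     (\<exists>C>0. \<forall>x\<in>X. \<forall>y\<in>Y.
        cone_gap (limiting_normal_cone X x) (limiting_normal_cone Y y) \<le> C * norm (x - y))"

text \<open>
  The little-o is two-sided and uniform in \<open>x\<close>, \<open>y\<close> and \<open>v\<close>; for bounded \<open>X\<close> this is the
  usual condition on sequences, see \<open>b_eq_regular_iff_sequential\<close>.
\<close>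

definition b_eq_regular :: "'a::euclidean_space set \<Rightarrow> 'a set \<Rightarrow> bool" where
  "b_eq_regular X Y \<longleftrightarrow>
     (\<forall>\<epsilon>>0. \<exists>\<delta>>0. \<forall>x\<in>X. \<forall>y\<in>Y. \<forall>v \<in> limiting_normal_cone X x \<inter> cball 0 1.
        norm (y - x) < \<delta> \<longrightarrow> \<bar>v \<bullet> (y - x)\<bar> \<le> \<epsilon> * norm (y - x))"

definition near ::
  "('a::topological_space set \<Rightarrow> 'a set \<Rightarrow> bool) \<Rightarrow> 'a set \<Rightarrow> 'a set \<Rightarrow> 'a \<Rightarrow> bool" where
  "near P X Y a \<longleftrightarrow> (\<exists>U. open U \<and> a \<in> U \<and> P (X \<inter> U) (Y \<inter> U))"

lemma frechet_normal_cone_scaleR: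
  assumes "v \<in> frechet_normal_cone Q x" "c > 0"
  shows "c *\<^sub>R v \<in> frechet_normal_cone Q x"
  unfolding frechet_normal_cone_def
proof (intro CollectI allI impI)
  fix \<epsilon> :: real
  assume "\<epsilon> > 0"
  then have "\<epsilon> / c > 0" using assms(2) by simp
  then have "\<forall>\<^sub>F y in at x within Q. v \<bullet> (y - x) \<le> (\<epsilon> / c) * norm (y - x)"
    using assms(1) unfolding frechet_normal_cone_def by blast
  then show "\<forall>\<^sub>F y in at x within Q. (c *\<^sub>R v) \<bullet> (y - x) \<le> \<epsilon> * norm (y - x)"
    by (rule eventually_mono) (use assms(2) in \<open>simp add: field_simps\<close>)
qed

lemma limiting_normal_cone_scaleR:
  assumes "v \<in> limiting_normal_cone Q x" "c > 0"
  shows "c *\<^sub>R v \<in> limiting_normal_cone Q x"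
proof -
  obtain xs vs where *: "\<And>i::nat. xs i \<in> Q \<and> vs i \<in> frechet_normal_cone Q (xs i)"
    "xs \<longlonglongrightarrow> x" "vs \<longlonglongrightarrow> v"
    using assms(1) unfolding limiting_normal_cone_def by blast
  have "(\<lambda>i. c *\<^sub>R vs i) \<longlonglongrightarrow> c *\<^sub>R v"
    by (intro tendsto_intros *)
  moreover have "xs i \<in> Q \<and> c *\<^sub>R vs i \<in> frechet_normal_cone Q (xs i)" for i
    using * frechet_normal_cone_scaleR assms(2) by blast
  ultimately show ?thesis
    unfolding limiting_normal_cone_def using *(2)
    by (intro CollectI exI[of _ xs] exI[of _ "\<lambda>i. c *\<^sub>R vs i"]) auto
qed

lemma b_eq_regular_iff_sequential:
  fixes X Y :: "'a::euclidean_space set"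
  assumes "bounded X"
  shows "b_eq_regular X Y \<longleftrightarrow>
    (\<forall>(x :: nat \<Rightarrow> 'a) y v z.
       (\<forall>i. x i \<in> X \<and> y i \<in> Y \<and> x i \<noteq> y i \<and> v i \<in> limiting_normal_cone X (x i) \<and> norm (v i) = 1)
       \<and> x \<longlonglongrightarrow> z \<and> y \<longlonglongrightarrow> z
       \<longrightarrow> (\<lambda>i. v i \<bullet> ((y i - x i) /\<^sub>R norm (y i - x i))) \<longlonglongrightarrow> 0)"
    (is "_ \<longleftrightarrow> ?S")
proof
  assume b: "b_eq_regular X Y"
  show ?S
  proof (intro allI impI, elim conjE)
    fix x y v :: "nat \<Rightarrow> 'a" and z
    assume h: "\<forall>i. x i \<in> X \<and> y i \<in> Y \<and> x i \<noteq> y i \<and>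
        v i \<in> limiting_normal_cone X (x i) \<and> norm (v i) = 1"
      and "x \<longlonglongrightarrow> z" "y \<longlonglongrightarrow> z"
    then have "(\<lambda>i. y i - x i) \<longlonglongrightarrow> 0"
      using tendsto_diff[of y z sequentially x z] by simp
    then have d: "(\<lambda>i. norm (y i - x i)) \<longlonglongrightarrow> 0"
      by (rule tendsto_norm_zero)
    show "(\<lambda>i. v i \<bullet> ((y i - x i) /\<^sub>R norm (y i - x i))) \<longlonglongrightarrow> 0"
    proof (rule LIMSEQ_I)
      fix r :: real
      assume "r > 0"
      then have "r / 2 > 0" by simp
      then obtain \<delta> where "\<delta> > 0" and \<delta>: "\<And>x y v. x \<in> X \<Longrightarrow> y \<in> Y \<Longrightarrow>
          v \<in> limiting_normal_cone X x \<inter> cball 0 1 \<Longrightarrow> norm (y - x) < \<delta> \<Longrightarrow>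
          \<bar>v \<bullet> (y - x)\<bar> \<le> r / 2 * norm (y - x)"
        using b unfolding b_eq_regular_def by meson
      obtain n where n: "\<And>i. i \<ge> n \<Longrightarrow> norm (y i - x i) < \<delta>"
        using LIMSEQ_D[OF d \<open>\<delta> > 0\<close>] by auto
      have "norm (v i \<bullet> ((y i - x i) /\<^sub>R norm (y i - x i)) - 0) < r" if "i \<ge> n" for i
      proof -
        have "\<bar>v i \<bullet> (y i - x i)\<bar> \<le> r / 2 * norm (y i - x i)"
          using h n[OF that] by (intro \<delta>) auto
        moreover have "norm (y i - x i) > 0" using h by (metis zero_less_norm_iff right_minus_eq)
        ultimately have "\<bar>v i \<bullet> (y i - x i)\<bar> / norm (y i - x i) \<le> r / 2"
          by (simp add: divide_le_eq)
        moreover have "v i \<bullet> ((y i - x i) /\<^sub>R norm (y i - x i)) =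
            (v i \<bullet> (y i - x i)) / norm (y i - x i)"
          by (simp only: inner_scaleR_right divide_inverse mult.commute)
        ultimately have "\<bar>v i \<bullet> ((y i - x i) /\<^sub>R norm (y i - x i))\<bar> \<le> r / 2"
          by (simp only: abs_divide abs_norm_cancel)
        then show ?thesis
          using \<open>r > 0\<close> by (simp only: real_norm_def diff_zero)
      qed
      then show "\<exists>n. \<forall>i\<ge>n. norm (v i \<bullet> ((y i - x i) /\<^sub>R norm (y i - x i)) - 0) < r"
        by blast
    qed
  qed
next
  assume S: ?S
  show "b_eq_regular X Y"
  proof (rule ccontr)
    assume "\<not> b_eq_regular X Y"
    then obtain \<epsilon> where "\<epsilon> > 0" and \<epsilon>: "\<And>\<delta>. \<delta> > 0 \<Longrightarrow> \<exists>x y v. x \<in> X \<and> y \<in> Y \<and>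
        v \<in> limiting_normal_cone X x \<inter> cball 0 1 \<and> norm (y - x) < \<delta> \<and>
        \<not> \<bar>v \<bullet> (y - x)\<bar> \<le> \<epsilon> * norm (y - x)"
      unfolding b_eq_regular_def by meson
    have "\<forall>i::nat. \<exists>x y v. x \<in> X \<and> y \<in> Y \<and>
        v \<in> limiting_normal_cone X x \<inter> cball 0 1 \<and> norm (y - x) < inverse (Suc i) \<and>
        \<not> \<bar>v \<bullet> (y - x)\<bar> \<le> \<epsilon> * norm (y - x)"
      by (intro allI \<epsilon>) simp
    then obtain x y v where h: "\<And>i::nat. x i \<in> X \<and> y i \<in> Y \<and>
        v i \<in> limiting_normal_cone X (x i) \<inter> cball 0 1 \<and>
        norm (y i - x i) < inverse (Suc i) \<and>
        \<not> \<bar>v i \<bullet> (y i - x i)\<bar> \<le> \<epsilon> * norm (y i - x i)"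
      by metis
    have ne: "x i \<noteq> y i" "v i \<noteq> 0" for i
    proof -
      show "x i \<noteq> y i" using h[of i] by force
      have "\<epsilon> * norm (y i - x i) \<ge> 0" using \<open>\<epsilon> > 0\<close> by simp
      then show "v i \<noteq> 0" using h[of i] by auto
    qed
    have "compact (closure X)" using assms by (simp add: compact_closure)
    moreover have "\<forall>i. x i \<in> closure X" using h closure_subset by blast
    ultimately obtain z r where r: "strict_mono (r :: nat \<Rightarrow> nat)" and xz: "(x \<circ> r) \<longlonglongrightarrow> z"
      unfolding compact_def by metis
    have "(\<lambda>i. y i - x i) \<longlonglongrightarrow> 0"
      by (rule Lim_null_comparison[OF _ LIMSEQ_inverse_real_of_nat])
        (use h in \<open>auto intro!: always_eventually less_imp_le\<close>)
    then have "((\<lambda>i. y i - x i) \<circ> r) \<longlonglongrightarrow> 0"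
      using r by (rule LIMSEQ_subseq_LIMSEQ)
    from tendsto_add[OF this xz] have yz: "(y \<circ> r) \<longlonglongrightarrow> z"
      by (simp add: o_def)
    define w where "w i = v (r i) /\<^sub>R norm (v (r i))" for i
    have "w i \<in> limiting_normal_cone X ((x \<circ> r) i) \<and> norm (w i) = 1" for i
      using h[of "r i"] ne[of "r i"] by (auto simp: w_def intro: limiting_normal_cone_scaleR)
    then have "(\<lambda>i. w i \<bullet> (((y \<circ> r) i - (x \<circ> r) i) /\<^sub>R norm ((y \<circ> r) i - (x \<circ> r) i))) \<longlonglongrightarrow> 0"
      using S[rule_format, of "x \<circ> r" "y \<circ> r" w z] h ne xz yz by auto
    from LIMSEQ_D[OF this \<open>\<epsilon> > 0\<close>] obtain i where
      i: "\<bar>w i \<bullet> ((y (r i) - x (r i)) /\<^sub>R norm (y (r i) - x (r i)))\<bar> < \<epsilon>"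
      by auto
    define d n where "d = norm (y (r i) - x (r i))" and "n = norm (v (r i))"
    have pos: "d > 0" "n > 0" "n \<le> 1"
      using ne[of "r i"] h[of "r i"] unfolding d_def n_def by simp_all
    have "w i \<bullet> ((y (r i) - x (r i)) /\<^sub>R d) = (v (r i) \<bullet> (y (r i) - x (r i))) / (n * d)"
      unfolding w_def n_def[symmetric] inner_scaleR_left inner_scaleR_right
      by (simp add: divide_inverse)
    moreover have "\<bar>w i \<bullet> ((y (r i) - x (r i)) /\<^sub>R d)\<bar> < \<epsilon>"
      using i unfolding d_def .
    ultimately have "\<bar>v (r i) \<bullet> (y (r i) - x (r i))\<bar> / (n * d) < \<epsilon>"
      using pos by (simp only: abs_divide abs_mult abs_of_pos)
    then have "\<bar>v (r i) \<bullet> (y (r i) - x (r i))\<bar> < \<epsilon> * (n * d)"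
      using pos by (simp add: divide_less_eq)
    also have "\<dots> \<le> \<epsilon> * d"
      using pos \<open>\<epsilon> > 0\<close> by (simp add: mult_left_le_one_le)
    finally show False
      using h[of "r i"] by (simp add: d_def)
  qed
qed

end

theory Submission
  imports Defs
begin

text \<open>
  Were the conclusion false, definable choice would give definable curves \<open>x(t) \<in> X\<close>, \<open>y(t) \<in> Y\<close>,
  for small \<open>t > 0\<close>, with unit normals \<open>v(t)\<close> to \<open>X\<close> at \<open>x(t)\<close> and normals \<open>w(t)\<close> to \<open>Y\<close> at
  \<open>y(t)\<close> such that \<open>u = y - x\<close> tends to \<open>0\<close>, \<open>\<bar>v \<bullet> u\<bar> > \<epsilon> \<bar>u\<bar>\<close> and \<open>\<bar>v - w\<bar> \<le> C \<bar>u\<bar>\<close>. Frechet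
  normals are orthogonal to the velocities of curves in the set, so \<open>v \<bullet> u' = v \<bullet> y' = (v - w) \<bullet> y'\<close>
  has modulus at most \<open>C \<bar>u\<bar> \<bar>y'\<bar>\<close>. Let \<open>v\<^sub>0 = lim v\<close> and \<open>g = \<bar>v\<^sub>0 \<bullet> u\<bar>\<close>. By o-minimality the
  inequality \<open>\<bar>u\<bar> \<le> K g\<close> passes to derivatives, coordinate by coordinate, whence
  \<open>g' \<le> K' g \<bar>y'\<bar>\<close>. As \<open>y\<close> is bounded with eventually monotone coordinates, it has finite length,
  so \<open>ln g\<close> is bounded below, contradicting \<open>u \<rightarrow> 0\<close>.
\<close>

section \<open>Definable sets and maps between Euclidean spaces\<close>

text \<open>Once definable choice has produced curves, o-minimality is needed only for one-sided
  germs of functions of one real variable, so cell decomposition is avoided.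

  For the choice, the bad configurations have to form a definable family. The Frechet cone is
  described by a formula over points and reals, whereas the limiting cone is defined through
  sequences; hence limiting normals are first replaced by Frechet normals. This works because every
  inequality involved is strict, and doubling the regularity constant makes strict the one that
  comes from the gap of the cones.

  The obstacle in the estimate is that the derivative of \<open>v\<close> is uncontrolled, so that
  \<open>v \<bullet> u\<close> cannot be differentiated usefully. Freezing \<open>v\<close> at its
  limit \<open>v\<^sub>0\<close> removes that term, at the price of an error
  \<open>(v - v\<^sub>0) \<bullet> u'\<close>. This error is harmless only if the size of
  \<open>u'\<close> is bounded by a multiple of \<open>g'\<close>, which is why the inequality
  between \<open>\<bar>u\<bar>\<close> and \<open>g\<close> has to be carried over to
  derivatives.\<close>

context o_minimal_structure
begin

lemma Int_mem: "A \<in> D n \<Longrightarrow> B \<in> D n \<Longrightarrow> A \<inter> B \<in> D n"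
proof -
  assume A: "A \<in> D n" and B: "B \<in> D n"
  have "A \<inter> B = Rn n - ((Rn n - A) \<union> (Rn n - B))"
    using subset_Rn[OF A] subset_Rn[OF B] by blast
  then show ?thesis using A B complement union by metis
qed

lemma finite_ball_mem:
  assumes "finite K" "\<And>k. k \<in> K \<Longrightarrow> {xs \<in> Rn n. P k xs} \<in> D n"
  shows "{xs \<in> Rn n. \<forall>k\<in>K. P k xs} \<in> D n"
  using assms
proof (induction K rule: finite_induct)
  case empty
  then show ?case using Rn_mem by simp
next
  case (insert k K)
  have "{xs \<in> Rn n. \<forall>k\<in>insert k K. P k xs} = {xs \<in> Rn n. P k xs} \<inter> {xs \<in> Rn n. \<forall>k\<in>K. P k xs}"
    by auto
  with insert show ?case using Int_mem by simp
qed

lemma take_image_mem: "A \<in> D (n + m) \<Longrightarrow> take n ` A \<in> D n"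
proof (induction m arbitrary: A)
  case 0
  have "take n ` A = A"
    using subset_Rn[OF 0] by (force simp: Rn_def)
  with 0 show ?case by simp
next
  case (Suc m)
  have "take n (butlast xs) = take n xs" if "xs \<in> A" for xs
    using that subset_Rn[OF Suc.prems] by (auto simp: Rn_def butlast_conv_take)
  then have "take n ` A = take n ` butlast ` A"
    by (simp add: image_image)
  with Suc projection show ?case by simp
qed

lemma Rn_append_mem:
  assumes "A \<in> D m"
  shows "{xs @ ys | xs ys. xs \<in> Rn n \<and> ys \<in> A} \<in> D (n + m)"
proof (induction n)
  case 0
  then show ?case using assms by (simp add: Rn_def)
next
  case (Suc n)
  have "{xs @ ys | xs ys. xs \<in> Rn (Suc n) \<and> ys \<in> A} =
      {t # zs | zs t. zs \<in> {xs @ ys | xs ys. xs \<in> Rn n \<and> ys \<in> A}}"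
    by (auto simp: Rn_def length_Suc_conv) (metis append_Cons)+
  with R_times[OF Suc] show ?case by simp
qed

lemma equal_coordinates_mem:
  assumes "i < n" "j < n"
  shows "{xs \<in> Rn n. xs ! i = xs ! j} \<in> D n"
proof -
  have "polynomial_fun n (\<lambda>xs. xs ! i + (-1) * xs ! j)"
    using assms by (intro polynomial_fun.intros)
  from zero_sets[OF this] show ?thesis by simp
qed

text \<open>Substitution of variables, with permutations and repetitions. The axioms offer only
  products and projections, so a tuple of \<open>A\<close> is appended to \<open>xs\<close>, its
  entries are equated with the prescribed entries of \<open>xs\<close>, and it is projected
  away.\<close>

lemma reindex_mem:
  assumes A: "A \<in> D m" and len: "length ks = m" and bound: "\<And>i. i \<in> set ks \<Longrightarrow> i < n"
  shows "{xs \<in> Rn n. map ((!) xs) ks \<in> A} \<in> D n"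
proof -
  let ?B = "{xs @ ys | xs ys. xs \<in> Rn n \<and> ys \<in> A}"
  let ?E = "{zs \<in> Rn (n + m). \<forall>k\<in>{..<m}. zs ! (ks ! k) = zs ! (n + k)}"
  have "?E \<in> D (n + m)"
    using bound len by (intro finite_ball_mem equal_coordinates_mem) (auto simp: trans_less_add1)
  then have "take n ` (?B \<inter> ?E) \<in> D n"
    using take_image_mem Int_mem[OF Rn_append_mem[OF A]] by blast
  also have "take n ` (?B \<inter> ?E) = {xs \<in> Rn n. map ((!) xs) ks \<in> A}" (is "?L = ?R")
  proof
    show "?L \<subseteq> ?R"
    proof
      fix xs assume "xs \<in> ?L"
      then obtain zs where zs: "zs \<in> ?B" "zs \<in> ?E" "xs = take n zs" by auto
      then obtain ys where ys: "zs = xs @ ys" "xs \<in> Rn n" "ys \<in> A"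
        by (auto simp: Rn_def)
      have "length ys = m" using ys(3) subset_Rn[OF A] by (auto simp: Rn_def)
      moreover have "xs ! (ks ! k) = ys ! k" if "k < m" for k
      proof -
        have "zs ! (ks ! k) = zs ! (n + k)" "ks ! k < n" "length xs = n"
          using zs(2) that ys(2) bound len by (auto simp: Rn_def)
        then show ?thesis by (simp add: ys(1) nth_append)
      qed
      ultimately have "map ((!) xs) ks = ys"
        using len by (intro nth_equalityI) auto
      with ys show "xs \<in> ?R" by simp
    qed
    show "?R \<subseteq> ?L"
    proof
      fix xs assume xs: "xs \<in> ?R"
      have "xs @ map ((!) xs) ks \<in> ?B \<inter> ?E"
        using xs len bound by (auto simp: Rn_def nth_append)
      then show "xs \<in> ?L" using xs by (force simp: Rn_def)
    qed
  qed
  finally show ?thesis .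
qed

end

section \<open>Coordinates of Euclidean spaces and independence of the order of the basis\<close>

definition coords :: "'a::euclidean_space list \<Rightarrow> 'a \<Rightarrow> real list" where
  "coords bs x = map (\<lambda>b. x \<bullet> b) bs"

definition basis_list :: "'a::euclidean_space list \<Rightarrow> bool" where
  "basis_list bs \<longleftrightarrow> distinct bs \<and> set bs = Basis"

lemma basis_list_length: "basis_list (bs :: 'a::euclidean_space list) \<Longrightarrow> length bs = DIM('a)"
  using distinct_card[of bs] by (simp add: basis_list_def)

lemma ex_basis_list: "\<exists>bs :: 'a::euclidean_space list. basis_list bs"
  using finite_distinct_list[of "Basis :: 'a set"] by (auto simp: basis_list_def)

lemma inj_coords: "basis_list bs \<Longrightarrow> inj (coords bs)"
proof (rule injI)
  fix x y assume "basis_list bs" "coords bs x = coords bs y"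
  then have "\<And>b. b \<in> Basis \<Longrightarrow> x \<bullet> b = y \<bullet> b"
    by (simp add: coords_def basis_list_def)
  then show "x = y" by (rule euclidean_eqI)
qed

lemma range_coords:
  fixes bs :: "'a::euclidean_space list"
  assumes "basis_list bs"
  shows "range (coords bs) = Rn DIM('a)"
proof
  show "range (coords bs) \<subseteq> Rn DIM('a)"
    using basis_list_length[OF assms] by (auto simp: coords_def Rn_def)
  show "Rn DIM('a) \<subseteq> range (coords bs)"
  proof
    fix xs :: "real list" assume xs: "xs \<in> Rn DIM('a)"
    let ?x = "\<Sum>b\<in>Basis. (the (map_of (zip bs xs) b)) *\<^sub>R b"
    have len: "length xs = length bs"
      using xs basis_list_length[OF assms] by (simp add: Rn_def)
    have "coords bs ?x = xs"
    proof (rule nth_equalityI)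
      show "length (coords bs ?x) = length xs" using len by (simp add: coords_def)
      fix i assume "i < length (coords bs ?x)"
      then have i: "i < length bs" by (simp add: coords_def)
      then have "bs ! i \<in> Basis" using nth_mem[OF i] assms unfolding basis_list_def by blast
      moreover have "map_of (zip bs xs) (bs ! i) = Some (xs ! i)"
        using assms i len by (simp add: basis_list_def map_of_zip_nth)
      ultimately show "coords bs ?x ! i = xs ! i"
        using i by (simp add: coords_def)
    qed
    then show "xs \<in> range (coords bs)" by (rule range_eqI[OF sym])
  qed
qed

text \<open>Links the coordinate-free polynomials of the library to \<open>polynomial_fun\<close>,
  the only functions mentioned in the axioms. The one case with content is a linear map, which is a
  linear form in the coordinates.\<close>

lemma real_polynomial_function_coords:
  fixes p :: "'a::euclidean_space \<Rightarrow> real"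
  assumes "real_polynomial_function p" and bs: "basis_list bs"
  shows "\<exists>q. polynomial_fun DIM('a) q \<and> (\<forall>z. p z = q (coords bs z))"
  using assms(1)
proof induction
  case (linear f)
  have *: "polynomial_fun DIM('a) (\<lambda>xs. \<Sum>k<m. f (bs ! k) * xs ! k)" if "m \<le> DIM('a)" for m
    using that by (induction m) (auto intro!: polynomial_fun.intros)
  have "f z = (\<Sum>k<DIM('a). f (bs ! k) * coords bs z ! k)" for z
  proof -
    have "f z = f (\<Sum>b\<in>Basis. (z \<bullet> b) *\<^sub>R b)" by (simp add: euclidean_representation)
    also have "\<dots> = (\<Sum>b\<in>set bs. f b * (z \<bullet> b))"
      using linear bs by (simp add: basis_list_def bounded_linear.linear linear_sum linear_scale mult.commute)
    also have "\<dots> = sum_list (map (\<lambda>b. f b * (z \<bullet> b)) bs)"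
      using bs by (simp add: basis_list_def sum_list_distinct_conv_sum_set)
    also have "\<dots> = (\<Sum>k<DIM('a). f (bs ! k) * coords bs z ! k)"
      using basis_list_length[OF bs] by (simp add: sum_list_sum_nth coords_def atLeast0LessThan)
    finally show ?thesis .
  qed
  with *[of "DIM('a)"] show ?case by blast
next
  case (const c)
  then show ?case by (auto intro: polynomial_fun.const)
next
  case (add f g)
  then obtain p q where "polynomial_fun DIM('a) p" "\<And>z. f z = p (coords bs z)"
    and "polynomial_fun DIM('a) q" "\<And>z. g z = q (coords bs z)" by blast
  then show ?case
    by (intro exI[of _ "\<lambda>xs. p xs + q xs"]) (simp add: polynomial_fun.add)
next
  case (mult f g)
  then obtain p q where "polynomial_fun DIM('a) p" "\<And>z. f z = p (coords bs z)"
    and "polynomial_fun DIM('a) q" "\<And>z. g z = q (coords bs z)" by blast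
  then show ?case
    by (intro exI[of _ "\<lambda>xs. p xs * q xs"]) (simp add: polynomial_fun.mult)
qed

context o_minimal_structure
begin

text \<open>\<open>definable\<close> supplies some order of the basis; passing to the order
  \<open>bs\<close> permutes coordinates, an instance of \<open>reindex_mem\<close>.
  \<open>ix b\<close> is the position of \<open>b\<close> in \<open>bs\<close>.\<close>

lemma definable_coords:
  fixes S :: "'a::euclidean_space set"
  assumes "definable D S" and bs: "basis_list bs"
  shows "coords bs ` S \<in> D DIM('a)"
proof -
  obtain cs where cs: "basis_list cs" and S: "coords cs ` S \<in> D DIM('a)"
    using assms(1) unfolding definable_def basis_list_def coords_def by blast
  define ix where "ix b = (SOME i. i < length bs \<and> bs ! i = b)" for b
  have ix: "ix b < length bs \<and> bs ! ix b = b" if "b \<in> Basis" for b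
    unfolding ix_def using that bs
    by (intro someI_ex[of "\<lambda>i. i < length bs \<and> bs ! i = b"]) (metis basis_list_def in_set_conv_nth)
  have ks: "map ((!) (coords bs x)) (map ix cs) = coords cs x" for x
    using ix cs by (auto simp: coords_def basis_list_def)
  have "{xs \<in> Rn DIM('a). map ((!) xs) (map ix cs) \<in> coords cs ` S} \<in> D DIM('a)"
    by (rule reindex_mem[OF S])
      (use ix bs cs in \<open>auto simp: basis_list_length basis_list_def[of cs]\<close>)
  also have "{xs \<in> Rn DIM('a). map ((!) xs) (map ix cs) \<in> coords cs ` S} = coords bs ` S"
    unfolding range_coords[OF bs, symmetric]
    by (auto simp: ks inj_eq[OF inj_coords[OF cs]] simp del: map_map)
  finally show ?thesis .
qed

lemma definableI: "basis_list bs \<Longrightarrow> coords bs ` S \<in> D DIM('a) \<Longrightarrow> definable D (S :: 'a::euclidean_space set)"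
  unfolding definable_def basis_list_def coords_def by blast

lemma definable_Compl: "definable D S \<Longrightarrow> definable D (- S)"
proof -
  fix S :: "'a::euclidean_space set"
  assume S: "definable D S"
  obtain bs :: "'a list" where bs: "basis_list bs" using ex_basis_list by blast
  have "coords bs ` (- S) = Rn DIM('a) - coords bs ` S"
    unfolding range_coords[OF bs, symmetric] using inj_coords[OF bs] by (auto dest: injD)
  then show "definable D (- S)"
    using definableI[OF bs] complement definable_coords[OF S bs] by simp
qed

lemma definable_Un: "definable D S \<Longrightarrow> definable D T \<Longrightarrow> definable D (S \<union> T)"
proof -
  fix S T :: "'a::euclidean_space set"
  assume S: "definable D S" and T: "definable D T"
  obtain bs :: "'a list" where bs: "basis_list bs" using ex_basis_list by blast
  show "definable D (S \<union> T)"
    using definableI[OF bs] union[OF definable_coords[OF S bs] definable_coords[OF T bs]]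
    by (simp add: image_Un)
qed

lemma definable_zero_set:
  fixes p :: "'a::euclidean_space \<Rightarrow> real"
  assumes "real_polynomial_function p"
  shows "definable D {z. p z = 0}"
proof -
  obtain bs :: "'a list" where bs: "basis_list bs" using ex_basis_list by blast
  obtain q where q: "polynomial_fun DIM('a) q" "\<And>z. p z = q (coords bs z)"
    using real_polynomial_function_coords[OF assms bs] by blast
  have "coords bs ` {z. p z = 0} = {xs \<in> Rn DIM('a). q xs = 0}"
    unfolding range_coords[OF bs, symmetric] using q(2) by auto
  then show ?thesis using definableI[OF bs] zero_sets[OF q(1)] by simp
qed

text \<open>This order of the product basis makes the coordinate list of a pair the concatenation of
  two lists, so that projections and cylinders in products become those of the axioms.\<close>

lemma product_basis_list:
  fixes as :: "'a::euclidean_space list" and bs :: "'b::euclidean_space list"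
  assumes "basis_list as" "basis_list bs"
  shows "basis_list (map (\<lambda>b. (b, 0)) as @ map (Pair 0) bs :: ('a \<times> 'b) list)"
proof -
  have "inj_on (\<lambda>b. (b, 0::'b)) (set as)" "inj_on (Pair (0::'a)) (set bs)"
    by (simp_all add: inj_on_def)
  moreover have "(\<lambda>b. (b, 0)) ` set as \<inter> Pair 0 ` set bs = {}"
    using assms nonzero_Basis by (auto simp: basis_list_def)
  ultimately show ?thesis
    using assms by (simp add: basis_list_def Basis_prod_def distinct_map)
qed

lemma coords_product:
  "coords (map (\<lambda>b. (b, 0)) as @ map (Pair 0) bs) z = coords as (fst z) @ coords bs (snd z)"
  by (cases z) (simp add: coords_def)

lemma definable_fst_image:
  fixes S :: "('a::euclidean_space \<times> 'b::euclidean_space) set"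
  assumes "definable D S"
  shows "definable D (fst ` S)"
proof -
  obtain as :: "'a list" where as: "basis_list as" using ex_basis_list by blast
  obtain bs :: "'b list" where bs: "basis_list bs" using ex_basis_list by blast
  have "coords as ` fst ` S = take DIM('a) ` coords (map (\<lambda>b. (b, 0)) as @ map (Pair 0) bs) ` S"
    using basis_list_length[OF as] by (simp add: image_image coords_product) (simp add: coords_def)
  then show ?thesis
    using definableI[OF as] take_image_mem definable_coords[OF assms product_basis_list[OF as bs]]
    by simp
qed

lemma definable_vimage_snd:
  fixes S :: "'b::euclidean_space set"
  assumes "definable D S"
  shows "definable D (snd -` S :: ('a::euclidean_space \<times> 'b) set)"
proof -
  obtain as :: "'a list" where as: "basis_list as" using ex_basis_list by blast
  obtain bs :: "'b list" where bs: "basis_list bs" using ex_basis_list by blast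
  have "coords (map (\<lambda>b. (b, 0)) as @ map (Pair 0) bs) ` (snd -` S :: ('a \<times> 'b) set) =
     {xs @ ys | xs ys. xs \<in> Rn DIM('a) \<and> ys \<in> coords bs ` S}"
    (is "?L = ?R")
  proof
    show "?L \<subseteq> ?R"
    proof
      fix zs assume "zs \<in> ?L"
      then obtain z where z: "snd z \<in> S" "zs = coords as (fst z) @ coords bs (snd z)"
        by (auto simp: coords_product)
      moreover have "coords as (fst z) \<in> Rn DIM('a)"
        using range_coords[OF as] by blast
      ultimately show "zs \<in> ?R" by blast
    qed
    show "?R \<subseteq> ?L"
    proof
      fix zs assume "zs \<in> ?R"
      then obtain x y where "y \<in> S" "zs = coords as x @ coords bs y"
        unfolding range_coords[OF as, symmetric] by auto
      then have "(x, y) \<in> snd -` S" "zs = coords (map (\<lambda>b. (b, 0)) as @ map (Pair 0) bs) (x, y)"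
        by (simp_all add: coords_product)
      then show "zs \<in> ?L" by (rule rev_image_eqI)
    qed
  qed
  then show ?thesis
    using definableI[OF product_basis_list[OF as bs]] Rn_append_mem definable_coords[OF assms bs]
    by simp
qed

text \<open>
  Contexts of variables are encoded as nested products of Euclidean spaces, so that the closure
  rules below can be applied by unification alone.
\<close>

definition dpred :: "('a::euclidean_space \<Rightarrow> bool) \<Rightarrow> bool" where
  "dpred P \<longleftrightarrow> definable D {z. P z}"

definition dmap :: "('a::euclidean_space \<Rightarrow> 'b::euclidean_space) \<Rightarrow> bool" where
  "dmap T \<longleftrightarrow> definable D {w. snd w = T (fst w)}"

lemma dpred_not: "dpred P \<Longrightarrow> dpred (\<lambda>z. \<not> P z)"
  unfolding dpred_def Collect_neg_eq by (rule definable_Compl)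

lemma dpred_disj: "dpred P \<Longrightarrow> dpred Q \<Longrightarrow> dpred (\<lambda>z. P z \<or> Q z)"
  unfolding dpred_def Collect_disj_eq by (rule definable_Un)

lemma dpred_conj:
  assumes "dpred P" "dpred Q"
  shows "dpred (\<lambda>z. P z \<and> Q z)"
proof -
  have "dpred (\<lambda>z. \<not> (\<not> P z \<or> \<not> Q z))"
    by (intro dpred_not dpred_disj assms)
  then show ?thesis by simp
qed

lemma dpred_imp:
  assumes "dpred P" "dpred Q"
  shows "dpred (\<lambda>z. P z \<longrightarrow> Q z)"
  unfolding imp_conv_disj by (intro dpred_not dpred_disj assms)

lemma dpred_ex:
  assumes "dpred (\<lambda>w. P (fst w) (snd w))"
  shows "dpred (\<lambda>z. \<exists>t. P z t)"
proof -
  have "{z. \<exists>t. P z t} = fst ` {w. P (fst w) (snd w)}"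
    by (simp add: set_eq_iff image_iff)
  then show ?thesis using assms definable_fst_image by (simp add: dpred_def)
qed

lemma dpred_all:
  assumes "dpred (\<lambda>w. P (fst w) (snd w))"
  shows "dpred (\<lambda>z. \<forall>t. P z t)"
proof -
  have "dpred (\<lambda>z. \<not> (\<exists>t. \<not> P z t))"
    by (intro dpred_not dpred_ex assms)
  then show ?thesis by simp
qed

text \<open>Substitution is a projection: \<open>P (T z)\<close> holds when some \<open>t\<close>
  satisfies \<open>P\<close> and lies on the graph of \<open>T\<close> over
  \<open>z\<close>.\<close>

lemma dpred_comp:
  assumes P: "dpred P" and T: "dmap T"
  shows "dpred (\<lambda>z. P (T z))"
proof -
  have "dpred (\<lambda>w. snd w = T (fst w))" using T by (simp add: dpred_def dmap_def)
  moreover have "dpred (\<lambda>w. P (snd w))"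
    using definable_vimage_snd[of "{z. P z}"] P by (simp add: dpred_def vimage_def)
  ultimately have "dpred (\<lambda>z. \<exists>t. t = T z \<and> P t)"
    by (intro dpred_ex dpred_conj)
  then show ?thesis by simp
qed

text \<open>A sum of squares turns the vector equation of the graph into a single polynomial
  equation.\<close>

lemma dmap_polynomial_function:
  assumes "polynomial_function T"
  shows "dmap (T :: 'a::euclidean_space \<Rightarrow> 'b::euclidean_space)"
proof -
  let ?p = "\<lambda>w. \<Sum>b\<in>Basis. ((T (fst w) - snd w) \<bullet> b) * ((T (fst w) - snd w) \<bullet> b)"
  have "polynomial_function (\<lambda>w :: 'a \<times> 'b. T (fst w) - snd w)"
    using polynomial_function_compose[OF polynomial_function_bounded_linear[OF bounded_linear_fst] assms]
    by (intro polynomial_function_diff polynomial_function_bounded_linear[OF bounded_linear_snd]) (simp add: o_def)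
  then have "real_polynomial_function (\<lambda>w. (T (fst w) - snd w) \<bullet> b)" for b
    using bounded_linear_inner_left[of b] unfolding polynomial_function_def o_def by blast
  then have "real_polynomial_function ?p"
    by (intro real_polynomial_function_sum finite_Basis real_polynomial_function.intros(4))
  moreover have "?p w = 0 \<longleftrightarrow> snd w = T (fst w)" for w
    unfolding euclidean_inner[symmetric] by auto
  ultimately show ?thesis
    using definable_zero_set[of ?p] by (simp add: dmap_def)
qed

lemma dmap_bounded_linear: "bounded_linear T \<Longrightarrow> dmap T"
  by (intro dmap_polynomial_function polynomial_function_bounded_linear)

lemma dmap_const: "dmap (\<lambda>z. c)"
  by (intro dmap_polynomial_function polynomial_function_const)

lemma dmap_ident: "dmap (\<lambda>z. z)"
  by (intro dmap_bounded_linear bounded_linear_ident)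

lemma dmap_comp:
  fixes T :: "'b::euclidean_space \<Rightarrow> 'c::euclidean_space" and S :: "'a::euclidean_space \<Rightarrow> 'b"
  assumes "dmap T" "dmap S"
  shows "dmap (\<lambda>z. T (S z))"
proof -
  have lin: "bounded_linear (\<lambda>q :: ('a \<times> 'c) \<times> 'b. (fst (fst q), snd q))"
      "bounded_linear (\<lambda>q :: ('a \<times> 'c) \<times> 'b. (snd q, snd (fst q)))"
    by (intro bounded_linear_intros)+
  have S: "dpred (\<lambda>w :: 'a \<times> 'b. snd w = S (fst w))" and T: "dpred (\<lambda>w :: 'b \<times> 'c. snd w = T (fst w))"
    using assms by (simp_all add: dpred_def dmap_def)
  have "dpred (\<lambda>w :: 'a \<times> 'c. \<exists>u. u = S (fst w) \<and> snd w = T u)"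
    using dpred_comp[OF S dmap_bounded_linear[OF lin(1)]] dpred_comp[OF T dmap_bounded_linear[OF lin(2)]]
    by (intro dpred_ex dpred_conj) simp_all
  then show ?thesis by (simp add: dpred_def dmap_def)
qed

lemma dmap_graphI: "dpred (\<lambda>w. snd w = T (fst w)) \<Longrightarrow> dmap T"
  by (simp add: dpred_def dmap_def)

lemma dmap_fst: "dmap T \<Longrightarrow> dmap (\<lambda>z. fst (T z))"
  using dmap_comp[OF dmap_bounded_linear[OF bounded_linear_fst]] .

lemma dmap_snd: "dmap T \<Longrightarrow> dmap (\<lambda>z. snd (T z))"
  using dmap_comp[OF dmap_bounded_linear[OF bounded_linear_snd]] .

lemma dpred_eq_ident: "dpred (\<lambda>w. fst w = snd w)"
  using dmap_ident unfolding dpred_def dmap_def by (simp add: eq_commute)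

lemma dmap_Pair:
  fixes T :: "'a::euclidean_space \<Rightarrow> 'b::euclidean_space" and S :: "'a \<Rightarrow> 'c::euclidean_space"
  assumes "dmap T" "dmap S"
  shows "dmap (\<lambda>z. (T z, S z))"
proof -
  have T: "dpred (\<lambda>w. snd w = T (fst w))" and S: "dpred (\<lambda>w. snd w = S (fst w))"
    using assms by (simp_all add: dpred_def dmap_def)
  have lin: "bounded_linear (\<lambda>q :: 'a \<times> ('b \<times> 'c). (fst q, fst (snd q)))"
      "bounded_linear (\<lambda>q :: 'a \<times> ('b \<times> 'c). (fst q, snd (snd q)))"
    by (intro bounded_linear_intros)+
  have "dpred (\<lambda>q. fst (snd q) = T (fst q) \<and> snd (snd q) = S (fst q))"
    using dpred_comp[OF T dmap_bounded_linear[OF lin(1)]] dpred_comp[OF S dmap_bounded_linear[OF lin(2)]]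
    by (intro dpred_conj) simp_all
  then show ?thesis by (intro dmap_graphI) (simp add: prod_eq_iff)
qed

lemma dpred_eq: "dmap T \<Longrightarrow> dmap S \<Longrightarrow> dpred (\<lambda>z. T z = S z)"
  using dpred_comp[OF dpred_eq_ident dmap_Pair] by simp

lemma dmap_add: "dmap T \<Longrightarrow> dmap S \<Longrightarrow> dmap (\<lambda>z. T z + S z)"
  using dmap_comp[OF dmap_bounded_linear[OF bounded_linear_add[OF bounded_linear_fst bounded_linear_snd]] dmap_Pair]
  by simp

lemma dmap_diff: "dmap T \<Longrightarrow> dmap S \<Longrightarrow> dmap (\<lambda>z. T z - S z)"
  using dmap_comp[OF dmap_bounded_linear[OF bounded_linear_sub[OF bounded_linear_fst bounded_linear_snd]] dmap_Pair]
  by simp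

lemma dmap_uminus: "dmap T \<Longrightarrow> dmap (\<lambda>z. - T z)"
  using dmap_diff[OF dmap_const[of 0]] by simp

lemma dmap_mult: "dmap T \<Longrightarrow> dmap S \<Longrightarrow> dmap (\<lambda>z. T z * S z :: real)"
proof -
  have "polynomial_function (\<lambda>z :: real \<times> real. fst z * snd z)"
    unfolding real_polynomial_function_eq[symmetric]
    by (intro real_polynomial_function.intros(4) real_polynomial_function.intros(1) bounded_linear_fst bounded_linear_snd)
  then show "dmap T \<Longrightarrow> dmap S \<Longrightarrow> ?thesis"
    using dmap_comp[OF dmap_polynomial_function dmap_Pair, of "\<lambda>z. fst z * snd z"] by simp
qed

lemma dmap_sum:
  "finite I \<Longrightarrow> (\<And>i. i \<in> I \<Longrightarrow> dmap (T i)) \<Longrightarrow> dmap (\<lambda>z. \<Sum>i\<in>I. T i z)"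
  by (induction I rule: finite_induct) (auto intro: dmap_const dmap_add)

lemma dmap_inner_const: "dmap T \<Longrightarrow> dmap (\<lambda>z. T z \<bullet> c)"
  using dmap_comp[OF dmap_bounded_linear[OF bounded_linear_inner_left]] .

lemma dmap_inner:
  assumes "dmap T" "dmap S"
  shows "dmap (\<lambda>z. T z \<bullet> S z)"
proof -
  have "dmap (\<lambda>z. \<Sum>b\<in>Basis. (T z \<bullet> b) * (S z \<bullet> b))"
    by (intro dmap_sum finite_Basis dmap_mult dmap_inner_const assms)
  then show ?thesis unfolding euclidean_inner[symmetric] .
qed

text \<open>The axioms speak of equations only; the order comes from the field, the nonnegative
  reals being the squares, with the root projected away.\<close>

lemma dpred_le: "dmap T \<Longrightarrow> dmap S \<Longrightarrow> dpred (\<lambda>z. T z \<le> (S z :: real))"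
proof -
  assume T: "dmap T" and S: "dmap S"
  have "dpred (\<lambda>z. \<exists>s. S z - T z = s * s)"
    by (intro dpred_ex dpred_eq dmap_diff dmap_mult dmap_snd dmap_ident
        dmap_comp[OF T dmap_fst] dmap_comp[OF S dmap_fst])
  moreover have "(\<exists>s. S z - T z = s * s) \<longleftrightarrow> T z \<le> S z" for z
  proof
    assume "T z \<le> S z"
    then have "S z - T z = sqrt (S z - T z) * sqrt (S z - T z)" by simp
    then show "\<exists>s. S z - T z = s * s" by blast
  next
    assume "\<exists>s. S z - T z = s * s"
    then show "T z \<le> S z" by (metis diff_ge_0_iff_ge zero_le_square)
  qed
  ultimately show ?thesis by simp
qed

lemma dpred_less: "dmap T \<Longrightarrow> dmap S \<Longrightarrow> dpred (\<lambda>z. T z < (S z :: real))"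
  using dpred_not[OF dpred_le[of S T]] by (simp add: not_le)

text \<open>The norm is not polynomial, but its graph is cut out by one polynomial equation and a
  sign condition.\<close>

lemma dmap_norm: "dmap T \<Longrightarrow> dmap (\<lambda>z. norm (T z))"
proof -
  have "dpred (\<lambda>w :: 'b \<times> real. 0 \<le> snd w \<and> snd w * snd w = fst w \<bullet> fst w)"
    by (intro dpred_conj dpred_le dpred_eq dmap_mult dmap_inner dmap_const dmap_snd dmap_fst dmap_ident)
  moreover have "(0 \<le> r \<and> r * r = x \<bullet> x) \<longleftrightarrow> r = norm x" for r and x :: 'b
    by (metis dot_square_norm norm_ge_zero power2_eq_square power2_eq_imp_eq)
  ultimately have "dmap (norm :: 'b \<Rightarrow> real)"
    by (intro dmap_graphI) simp
  then show "dmap T \<Longrightarrow> ?thesis" by (rule dmap_comp)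
qed

lemma dmap_abs: "dmap T \<Longrightarrow> dmap (\<lambda>z. \<bar>T z :: real\<bar>)"
  using dmap_norm[of T] by simp

lemma dpred_mem: "definable D S \<Longrightarrow> dmap T \<Longrightarrow> dpred (\<lambda>z. T z \<in> S)"
  using dpred_comp[of "\<lambda>z. z \<in> S"] by (simp add: dpred_def)

lemmas dmap_intros = dmap_const dmap_ident dmap_fst dmap_snd dmap_Pair dmap_add dmap_diff
  dmap_uminus dmap_mult dmap_inner dmap_norm dmap_abs

lemmas dpred_intros = dpred_not dpred_conj dpred_disj dpred_imp dpred_ex dpred_all
  dpred_eq dpred_le dpred_less

text \<open>Written with epsilon and delta, the Frechet condition quantifies over reals and points
  only, so the closure rules apply to it.\<close>

lemma dpred_frechet_normal_cone:
  assumes "definable D X" "dmap x" "dmap v"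
  shows "dpred (\<lambda>z. v z \<in> frechet_normal_cone X (x z))"
proof -
  have "dpred (\<lambda>z. \<forall>\<epsilon>::real. 0 < \<epsilon> \<longrightarrow> (\<exists>\<delta>::real. 0 < \<delta> \<and> (\<forall>y. y \<in> X \<longrightarrow> y \<noteq> x z \<and> norm (y - x z) < \<delta> \<longrightarrow>
      v z \<bullet> (y - x z) \<le> \<epsilon> * norm (y - x z))))"
    by (intro dpred_intros dmap_intros dpred_mem[OF assms(1)]
        dmap_comp[OF assms(2)] dmap_comp[OF assms(3)])
  moreover have "v z \<in> frechet_normal_cone X (x z) \<longleftrightarrow> (\<forall>\<epsilon>::real. 0 < \<epsilon> \<longrightarrow> (\<exists>\<delta>::real. 0 < \<delta> \<and>
      (\<forall>y. y \<in> X \<longrightarrow> y \<noteq> x z \<and> norm (y - x z) < \<delta> \<longrightarrow> v z \<bullet> (y - x z) \<le> \<epsilon> * norm (y - x z))))" for z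
    unfolding frechet_normal_cone_def eventually_at dist_norm Ball_def mem_Collect_eq ..
  ultimately show ?thesis by simp
qed

end

section \<open>Germs of definable functions of one variable\<close>

text \<open>If \<open>I\<close> is not eventually avoided, it has points arbitrarily close to
  \<open>c\<close> on the right, and convexity fills the space between them.\<close>

lemma is_interval_germ:
  fixes I :: "real set"
  assumes "is_interval I"
  shows "(\<forall>\<^sub>F t in at_right c. t \<in> I) \<or> (\<forall>\<^sub>F t in at_right c. t \<notin> I)"
proof (rule disjCI)
  assume *: "\<not> (\<forall>\<^sub>F t in at_right c. t \<notin> I)"
  have pts: "\<exists>s\<in>I. c < s \<and> s < d" if "c < d" for d
    using * that unfolding eventually_at_right_field by blast
  obtain d where d: "d \<in> I" "c < d" using pts[of "c + 1"] by auto
  have "t \<in> I" if t: "c < t" "t < d" for t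
  proof -
    obtain s where "s \<in> I" "s < t" using pts[OF t(1)] by blast
    then show ?thesis using assms d(1) t(2) mem_is_interval_1_I[of I s d t] by simp
  qed
  then show "\<forall>\<^sub>F t in at_right c. t \<in> I"
    using d(2) unfolding eventually_at_right_field by blast
qed

lemma finite_union_germ:
  assumes "finite \<I>" "\<forall>I\<in>\<I>. is_interval (I :: real set)"
  shows "(\<forall>\<^sub>F t in at_right c. t \<in> \<Union>\<I>) \<or> (\<forall>\<^sub>F t in at_right c. t \<notin> \<Union>\<I>)"
proof (cases "\<exists>I\<in>\<I>. \<forall>\<^sub>F t in at_right c. t \<in> I")
  case True
  then obtain I where I: "I \<in> \<I>" "\<forall>\<^sub>F t in at_right c. t \<in> I" by blast
  have "\<forall>\<^sub>F t in at_right c. t \<in> \<Union>\<I>"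
    using I(2) by (rule eventually_mono) (use I(1) in blast)
  then show ?thesis ..
next
  case False
  then have "\<forall>I\<in>\<I>. \<forall>\<^sub>F t in at_right c. t \<notin> I"
    using assms(2) is_interval_germ by blast
  then have "\<forall>\<^sub>F t in at_right c. \<forall>I\<in>\<I>. t \<notin> I"
    using assms(1) by (simp add: eventually_ball_finite_distrib)
  then show ?thesis by simp
qed

text \<open>An open interval contains at most one point whose value exceeds all others there, and
  every strict local maximum is such a point for some interval with rational end points.\<close>

lemma countable_strict_local_maxima:
  fixes g :: "real \<Rightarrow> real"
  shows "countable {t. \<forall>\<^sub>F s in at t. g s < g t}"
proof -
  let ?A = "\<lambda>p q. {t. p < t \<and> t < q \<and> (\<forall>s. p < s \<and> s < q \<and> s \<noteq> t \<longrightarrow> g s < g t)}"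
  have "countable (?A p q)" for p q
  proof -
    have "t = t'" if "t \<in> ?A p q" "t' \<in> ?A p q" for t t'
      using that by (metis (mono_tags, lifting) mem_Collect_eq order_less_asym)
    then obtain t where "?A p q \<subseteq> {t}" by blast
    then have "finite (?A p q)" by (rule finite_subset) simp
    then show ?thesis by (rule countable_finite)
  qed
  then have "countable (\<Union>p\<in>\<rat>. \<Union>q\<in>\<rat>. ?A p q)"
    by (intro countable_UN countable_rat)
  moreover have "{t. \<forall>\<^sub>F s in at t. g s < g t} \<subseteq> (\<Union>p\<in>\<rat>. \<Union>q\<in>\<rat>. ?A p q)"
  proof
    fix t assume "t \<in> {t. \<forall>\<^sub>F s in at t. g s < g t}"
    then obtain d where d: "d > 0" "\<And>s. s \<noteq> t \<Longrightarrow> dist s t < d \<Longrightarrow> g s < g t"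
      unfolding eventually_at by auto
    obtain p where p: "p \<in> \<rat>" "t - d < p" "p < t" using Rats_dense_in_real[of "t - d" t] d(1) by auto
    obtain q where q: "q \<in> \<rat>" "t < q" "q < t + d" using Rats_dense_in_real[of t "t + d"] d(1) by auto
    have "g s < g t" if "p < s" "s < q" "s \<noteq> t" for s
      using that p q by (intro d(2)) (auto simp: dist_real_def)
    with p q show "t \<in> (\<Union>p\<in>\<rat>. \<Union>q\<in>\<rat>. ?A p q)" by blast
  qed
  ultimately show ?thesis by (rule countable_subset[rotated])
qed

text \<open>The limit is the cut formed by the \<open>r\<close> that are eventually below
  \<open>g\<close>; the dichotomy puts every other \<open>r\<close> eventually above or equal. An
  arbitrary filter is allowed so that both sides of a point are covered.\<close>

lemma ex_ereal_limit:
  fixes g :: "'a \<Rightarrow> real"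
  assumes "\<And>r. (\<forall>\<^sub>F s in F. r < g s) \<or> (\<forall>\<^sub>F s in F. \<not> r < g s)"
  shows "\<exists>l. ((\<lambda>s. ereal (g s)) \<longlongrightarrow> l) F"
proof
  let ?l = "SUP r\<in>{r. \<forall>\<^sub>F s in F. r < g s}. ereal r"
  show "((\<lambda>s. ereal (g s)) \<longlongrightarrow> ?l) F"
  proof (rule order_tendstoI)
    fix a assume "a < ?l"
    then obtain r where r: "\<forall>\<^sub>F s in F. r < g s" "a < ereal r"
      unfolding less_SUP_iff by blast
    from r(1) show "\<forall>\<^sub>F s in F. a < ereal (g s)"
      by (rule eventually_mono) (use r(2) in \<open>simp add: less_trans[OF r(2)]\<close>)
  next
    fix a assume "?l < a"
    then obtain r where r: "?l < ereal r" "ereal r < a"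
      using ereal_dense2 by blast
    have "\<not> (\<forall>\<^sub>F s in F. r < g s)"
    proof
      assume "\<forall>\<^sub>F s in F. r < g s"
      then have "ereal r \<le> ?l" by (intro SUP_upper) simp
      with r(1) show False by simp
    qed
    then have "\<forall>\<^sub>F s in F. \<not> r < g s" using assms by blast
    then show "\<forall>\<^sub>F s in F. ereal (g s) < a"
    proof (rule eventually_mono)
      fix s assume "\<not> r < g s"
      then have "ereal (g s) \<le> ereal r" by simp
      then show "ereal (g s) < a" using r(2) by (rule le_less_trans)
    qed
  qed
qed

lemma locally_increasing_le:
  fixes g :: "real \<Rightarrow> real"
  assumes "a \<le> b"
    and "\<And>t. a \<le> t \<Longrightarrow> t \<le> b \<Longrightarrow> \<forall>\<^sub>F s in at_right t. g t \<le> g s"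
    and "\<And>t. a \<le> t \<Longrightarrow> t \<le> b \<Longrightarrow> \<forall>\<^sub>F s in at_left t. g s \<le> g t"
  shows "g a \<le> g b"
  using assms(1)
proof (induction a b rule: Bolzano)
  case (trans a b c)
  then show ?case by simp
next
  case (local t)
  obtain p where p: "t < p" "\<And>s. t < s \<Longrightarrow> s < p \<Longrightarrow> g t \<le> g s"
    using assms(2)[OF local] unfolding eventually_at_right_field by blast
  obtain q where q: "q < t" "\<And>s. q < s \<Longrightarrow> s < t \<Longrightarrow> g s \<le> g t"
    using assms(3)[OF local] unfolding eventually_at_left_field by blast
  show ?case
  proof (intro exI[of _ "min (p - t) (t - q)"] conjI allI impI)
    fix a' b' assume ab: "a' \<le> t \<and> t \<le> b' \<and> b' - a' < min (p - t) (t - q)"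
    have "g a' \<le> g t" using q(2)[of a'] ab by (cases "a' = t") auto
    also have "g t \<le> g b'" using p(2)[of b'] ab by (cases "b' = t") auto
    finally show "g a' \<le> g b'" .
  qed (use p q in auto)
qed

lemma infinite_derivative_on_interval:
  fixes f :: "real \<Rightarrow> real"
  assumes "a < b"
    and r: "\<And>t M. a \<le> t \<Longrightarrow> t \<le> b \<Longrightarrow> \<forall>\<^sub>F s in at_right t. M * (s - t) < f s - f t"
    and l: "\<And>t M. a \<le> t \<Longrightarrow> t \<le> b \<Longrightarrow> \<forall>\<^sub>F s in at_left t. f s - f t < M * (s - t)"
  shows False
proof -
  \<comment> \<open>One more than the slope of the chord: \<open>f t - M * t\<close> is locally
    increasing, which forces the chord to have slope at least \<open>M\<close>.\<close>
  define M where "M = (f b - f a) / (b - a) + 1"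
  have "f a - M * a \<le> f b - M * b"
  proof (rule locally_increasing_le[where g = "\<lambda>t. f t - M * t"])
    fix t assume t: "a \<le> t" "t \<le> b"
    show "\<forall>\<^sub>F s in at_right t. f t - M * t \<le> f s - M * s"
      using r[OF t, of M] by (rule eventually_mono) (simp add: algebra_simps)
    show "\<forall>\<^sub>F s in at_left t. f s - M * s \<le> f t - M * t"
      using l[OF t, of M] by (rule eventually_mono) (simp add: algebra_simps)
  qed (use assms(1) in simp)
  then have "M * (b - a) \<le> f b - f a" by (simp add: algebra_simps)
  moreover have "M * (b - a) = f b - f a + (b - a)"
    using assms(1) by (simp add: M_def distrib_right)
  ultimately show False using assms(1) by simp
qed

context o_minimal_structure
begin

text \<open>The place where the axiom \<open>line\<close> enters: a definable condition on a real
  variable is eventually settled on each side of a point. All limits, derivatives and signs below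
  rest on this dichotomy.\<close>

lemma dpred_germ:
  fixes P :: "real \<Rightarrow> bool"
  assumes "dpred P"
  shows "(\<forall>\<^sub>F t in at_right c. P t) \<or> (\<forall>\<^sub>F t in at_right c. \<not> P t)"
proof -
  have "basis_list [1 :: real]" by (simp add: basis_list_def)
  from definable_coords[OF assms[unfolded dpred_def] this]
  have "(\<lambda>t. [t]) ` {t. P t} \<in> D 1"
    by (simp add: coords_def[abs_def])
  then obtain \<I> where \<I>: "finite \<I>" "\<forall>I\<in>\<I>. is_interval (I :: real set)"
    and "(\<lambda>t. [t]) ` {t. P t} = (\<lambda>t. [t]) ` \<Union>\<I>"
    unfolding line by blast
  then have "{t. P t} = \<Union>\<I>"
    by (subst (asm) inj_image_eq_iff) (auto simp: inj_def)
  then have "P t \<longleftrightarrow> t \<in> \<Union>\<I>" for t by blast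
  with finite_union_germ[OF \<I>, of c] show ?thesis by simp
qed

lemma dpred_germ_left:
  fixes P :: "real \<Rightarrow> bool"
  assumes "dpred P"
  shows "(\<forall>\<^sub>F t in at_left c. P t) \<or> (\<forall>\<^sub>F t in at_left c. \<not> P t)"
  unfolding eventually_at_left_to_right[of _ c]
  by (intro dpred_germ dpred_comp[OF assms] dmap_uminus dmap_ident)

lemma dpred_eventually_at_right:
  fixes c :: "'b::euclidean_space \<Rightarrow> real"
  assumes "dpred (\<lambda>w. P (fst w) (snd w))" "dmap c"
  shows "dpred (\<lambda>z. eventually (P z) (at_right (c z)))"
  unfolding eventually_at_right_field
  by (intro dpred_intros dmap_intros dmap_comp[OF assms(2)]
      dpred_comp[OF assms(1), of "\<lambda>w. (fst (fst w), snd w)", simplified])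

lemma dpred_eventually_at_left:
  fixes c :: "'b::euclidean_space \<Rightarrow> real"
  assumes "dpred (\<lambda>w. P (fst w) (snd w))" "dmap c"
  shows "dpred (\<lambda>z. eventually (P z) (at_left (c z)))"
  unfolding eventually_at_left_field
  by (intro dpred_intros dmap_intros dmap_comp[OF assms(2)]
      dpred_comp[OF assms(1), of "\<lambda>w. (fst (fst w), snd w)", simplified])

lemma dpred_has_real_derivative:
  assumes "dmap f" "dmap l" "dmap t"
  shows "dpred (\<lambda>z. (f has_real_derivative l z) (at (t z)))"
proof -
  have "dpred (\<lambda>z. \<forall>e::real. 0 < e \<longrightarrow> (\<exists>d::real. 0 < d \<and> (\<forall>y. norm (y - t z) < d \<longrightarrow>
      norm (f y - f (t z) - l z * (y - t z)) \<le> e * norm (y - t z))))"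
    by (intro dpred_intros dmap_intros dmap_comp[OF assms(1)] dmap_comp[OF assms(2)] dmap_comp[OF assms(3)])
  then show ?thesis
    by (simp add: has_field_derivative_def has_derivative_at_alt bounded_linear_mult_right)
qed

text \<open>
  One-sided derivatives always exist in the extended reals. They differ only at countably many
  points, since each such point is a strict local extremum of \<open>f - r t\<close> for some rational \<open>r\<close>,
  and they cannot both be \<open>\<infinity>\<close> throughout an interval.
\<close>

lemma eventually_differentiable:
  fixes f :: "real \<Rightarrow> real"
  assumes f: "dmap f"
  shows "\<forall>\<^sub>F t in at_right c. \<exists>l. (f has_real_derivative l) (at t)"
proof (rule ccontr)
  assume "\<not> ?thesis"
  \<comment> \<open>By the dichotomy, the failure to be eventually differentiable means being
    differentiable nowhere on some interval to the right of \<open>c\<close>.\<close>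
  then have nd: "\<forall>\<^sub>F t in at_right c. \<not> (\<exists>l. (f has_real_derivative l) (at t))"
    using dpred_germ[OF dpred_ex[OF dpred_has_real_derivative[OF f dmap_snd[OF dmap_ident] dmap_fst[OF dmap_ident]]]]
    by blast
  \<comment> \<open>\<open>R h t M\<close> and \<open>L h t M\<close> say that the difference
    quotients of \<open>h\<close> at \<open>t\<close> exceed \<open>M\<close> near \<open>t\<close>
    on the right and on the left, where \<open>s - t\<close> is negative. For all \<open>M\<close>
    together they express the derivative \<open>+\<infinity>\<close>.\<close>
  define R where "R h t M \<longleftrightarrow> (\<forall>\<^sub>F s in at_right t. M * (s - t) < h s - h t)" for h :: "real \<Rightarrow> real" and t M
  define L where "L h t M \<longleftrightarrow> (\<forall>\<^sub>F s in at_left t. h s - h t < M * (s - t))" for h :: "real \<Rightarrow> real" and t M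
  have fin: "\<forall>\<^sub>F t in at_right c. \<not> (\<forall>M. R h t M \<and> L h t M)" if h: "dmap h" for h
  proof -
    have "dpred (\<lambda>t. \<forall>M. R h t M \<and> L h t M)"
      unfolding R_def L_def
      by (intro dpred_intros dpred_eventually_at_right dpred_eventually_at_left dmap_intros dmap_comp[OF h])
    then consider "\<forall>\<^sub>F t in at_right c. \<forall>M. R h t M \<and> L h t M" | "\<forall>\<^sub>F t in at_right c. \<not> (\<forall>M. R h t M \<and> L h t M)"
      using dpred_germ by blast
    then show ?thesis
    proof cases
      case 1
      then obtain b where b: "c < b" "\<And>t. c < t \<Longrightarrow> t < b \<Longrightarrow> \<forall>M. R h t M \<and> L h t M"
        unfolding eventually_at_right_field by blast
      \<comment> \<open>Interior points, because the one-sided estimates are also needed at the end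
        points of the closed interval.\<close>
      define p q where "p = c + (b - c) / 3" and "q = c + 2 * (b - c) / 3"
      have "c < p" "p < q" "q < b" using b(1) by (auto simp: p_def q_def field_simps)
      then have False
        by (intro infinite_derivative_on_interval[of p q h]) (use b(2) in \<open>auto simp: R_def L_def\<close>)
      then show ?thesis ..
    qed
  qed
  \<comment> \<open>Strict local minima of \<open>f s - r * s\<close> enter as maxima of
    \<open>- f s - (- r) * s\<close>; hence this set is needed for \<open>f\<close> and for its
    negative.\<close>
  define N where "N h = (\<Union>r\<in>\<rat>. {t. \<forall>\<^sub>F s in at t. h s - r * s < h t - r * t})" for h :: "real \<Rightarrow> real"
  have countable_N: "countable (N h)" for h
    unfolding N_def by (intro countable_UN countable_rat countable_strict_local_maxima)
  have "\<forall>\<^sub>F t in at_right c. t \<in> N f \<union> N (\<lambda>s. - f s)"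
    using nd fin[OF f] fin[OF dmap_uminus[OF f]]
  proof eventually_elim
    case (elim t)
    let ?q = "\<lambda>s. (f s - f t) / (s - t)"
    have less_q: "r < ?q s \<longleftrightarrow> r * (s - t) < f s - f t" if "t < s" for r s
      using that by (simp add: less_divide_eq)
    have less_q': "r < ?q s \<longleftrightarrow> f s - f t < r * (s - t)" if "s < t" for r s
      using that by (simp add: less_divide_eq)
    have evr: "(\<forall>\<^sub>F s in at_right t. r < ?q s) \<longleftrightarrow> (\<forall>\<^sub>F s in at_right t. r * (s - t) < f s - f t)"
      "(\<forall>\<^sub>F s in at_right t. \<not> r < ?q s) \<longleftrightarrow> (\<forall>\<^sub>F s in at_right t. \<not> r * (s - t) < f s - f t)" for r
      by (intro eventually_cong; use less_q in \<open>auto intro!: eventually_at_rightI[of t "t + 1"]\<close>)+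
    have evl: "(\<forall>\<^sub>F s in at_left t. r < ?q s) \<longleftrightarrow> (\<forall>\<^sub>F s in at_left t. f s - f t < r * (s - t))"
      "(\<forall>\<^sub>F s in at_left t. \<not> r < ?q s) \<longleftrightarrow> (\<forall>\<^sub>F s in at_left t. \<not> f s - f t < r * (s - t))" for r
      by (intro eventually_cong; use less_q' in \<open>auto intro!: eventually_at_leftI[of "t - 1" t]\<close>)+
    obtain u where u: "((\<lambda>s. ereal (?q s)) \<longlongrightarrow> u) (at_right t)"
      using ex_ereal_limit[where F = "at_right t" and g = ?q, unfolded evr]
      by (metis (no_types) dpred_germ[OF dpred_less[OF dmap_mult[OF dmap_const dmap_diff[OF dmap_ident dmap_const]] dmap_diff[OF f dmap_const]]])
    obtain l where l: "((\<lambda>s. ereal (?q s)) \<longlongrightarrow> l) (at_left t)"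
      using ex_ereal_limit[where F = "at_left t" and g = ?q, unfolded evl]
      by (metis (no_types) dpred_germ_left[OF dpred_less[OF dmap_diff[OF f dmap_const] dmap_mult[OF dmap_const dmap_diff[OF dmap_ident dmap_const]]]])
    \<comment> \<open>\<open>u\<close> and \<open>l\<close> are the right and left derivatives. If
      they differ, \<open>t\<close> lies in one of the two countable sets; a common infinite value
      is excluded by \<open>fin\<close> for \<open>f\<close> or its negative, a common finite value
      by \<open>nd\<close>.\<close>
    consider "u < l" | "l < u" | "u = l" "l = \<infinity>" | "u = l" "l = -\<infinity>" | d where "u = l" "l = ereal d"
      by (metis ereal_cases less_linear)
    then show ?case
    proof cases
      case 1
      obtain r where r: "r \<in> \<rat>" "u < ereal r" "ereal r < l"
        using ereal_dense3[OF 1] by (auto simp: Rats_def)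
      have "\<forall>\<^sub>F s in at_right t. ?q s < r" using order_tendstoD(2)[OF u r(2)] by simp
      moreover have "\<forall>\<^sub>F s in at_right t. t < s" by (auto intro: eventually_at_rightI[of t "t + 1"])
      ultimately have "\<forall>\<^sub>F s in at_right t. f s - r * s < f t - r * t"
        by eventually_elim (simp add: divide_less_eq algebra_simps)
      moreover have "\<forall>\<^sub>F s in at_left t. f s - r * s < f t - r * t"
      proof -
        have "\<forall>\<^sub>F s in at_left t. r < ?q s" using order_tendstoD(1)[OF l r(3)] by simp
        moreover have "\<forall>\<^sub>F s in at_left t. s < t" by (auto intro: eventually_at_leftI[of "t - 1" t])
        ultimately show ?thesis
          by eventually_elim (simp add: less_divide_eq algebra_simps)
      qed
      ultimately have "\<forall>\<^sub>F s in at t. f s - r * s < f t - r * t"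
        by (simp add: eventually_at_split)
      then have "t \<in> N f" using r(1) unfolding N_def by blast
      then show ?thesis ..
    next
      case 2
      obtain r where r: "r \<in> \<rat>" "l < ereal r" "ereal r < u"
        using ereal_dense3[OF 2] by (auto simp: Rats_def)
      have "\<forall>\<^sub>F s in at_right t. r < ?q s" using order_tendstoD(1)[OF u r(3)] by simp
      moreover have "\<forall>\<^sub>F s in at_right t. t < s" by (auto intro: eventually_at_rightI[of t "t + 1"])
      ultimately have "\<forall>\<^sub>F s in at_right t. - f s - (- r) * s < - f t - (- r) * t"
        by eventually_elim (simp add: less_divide_eq algebra_simps)
      moreover have "\<forall>\<^sub>F s in at_left t. - f s - (- r) * s < - f t - (- r) * t"
      proof -
        have "\<forall>\<^sub>F s in at_left t. ?q s < r" using order_tendstoD(2)[OF l r(2)] by simp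
        moreover have "\<forall>\<^sub>F s in at_left t. s < t" by (auto intro: eventually_at_leftI[of "t - 1" t])
        ultimately show ?thesis
          by eventually_elim (simp add: divide_less_eq algebra_simps)
      qed
      ultimately have "\<forall>\<^sub>F s in at t. - f s - (- r) * s < - f t - (- r) * t"
        by (simp add: eventually_at_split)
      moreover have "- r \<in> \<rat>" using r(1) by simp
      ultimately have "t \<in> N (\<lambda>s. - f s)" unfolding N_def by blast
      then show ?thesis ..
    next
      case 3
      have "R f t M \<and> L f t M" for M
        using order_tendstoD(1)[OF u, of "ereal M"] order_tendstoD(1)[OF l, of "ereal M"] 3
        by (simp add: R_def L_def evr evl)
      with elim(2) show ?thesis by blast
    next
      case 4
      have "R (\<lambda>s. - f s) t M \<and> L (\<lambda>s. - f s) t M" for M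
      proof
        have "\<forall>\<^sub>F s in at_right t. ?q s < - M" using order_tendstoD(2)[OF u, of "ereal (- M)"] 4 by simp
        moreover have "\<forall>\<^sub>F s in at_right t. t < s" by (auto intro: eventually_at_rightI[of t "t + 1"])
        ultimately show "R (\<lambda>s. - f s) t M"
          unfolding R_def by eventually_elim (simp add: divide_less_eq algebra_simps)
        have "\<forall>\<^sub>F s in at_left t. ?q s < - M" using order_tendstoD(2)[OF l, of "ereal (- M)"] 4 by simp
        moreover have "\<forall>\<^sub>F s in at_left t. s < t" by (auto intro: eventually_at_leftI[of "t - 1" t])
        ultimately show "L (\<lambda>s. - f s) t M"
          unfolding L_def by eventually_elim (simp add: divide_less_eq algebra_simps)
      qed
      with elim(3) show ?thesis by blast
    next
      case 5
      then have "(?q \<longlongrightarrow> d) (at t)"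
        using u l by (simp add: filterlim_split_at)
      then have "(f has_real_derivative d) (at t)"
        by (simp add: has_field_derivative_iff)
      with elim(1) show ?thesis by blast
    qed
  qed
  then obtain b where b: "c < b" "\<And>t. c < t \<Longrightarrow> t < b \<Longrightarrow> t \<in> N f \<union> N (\<lambda>s. - f s)"
    unfolding eventually_at_right_field by blast
  have "{c<..<b} \<subseteq> N f \<union> N (\<lambda>s. - f s)"
    by (intro subsetI b(2)) simp_all
  then have "countable {c<..<b}"
    by (rule countable_subset) (intro countable_Un countable_N)
  with uncountable_open_interval b(1) show False by blast
qed

end

section \<open>Definable choice and calculus of germs\<close>

text \<open>A relation spelled out with quantifiers, so that unfolding it leaves a formula to which
  the closure rules for definable predicates apply.\<close>

definition is_inf :: "(real \<Rightarrow> bool) \<Rightarrow> real \<Rightarrow> bool" where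
  "is_inf Q m \<longleftrightarrow> (\<forall>s. Q s \<longrightarrow> m \<le> s) \<and> (\<forall>m'. (\<forall>s. Q s \<longrightarrow> m' \<le> s) \<longrightarrow> m' \<le> m)"

definition is_sup :: "(real \<Rightarrow> bool) \<Rightarrow> real \<Rightarrow> bool" where
  "is_sup Q m \<longleftrightarrow> (\<forall>s. Q s \<longrightarrow> s \<le> m) \<and> (\<forall>m'. (\<forall>s. Q s \<longrightarrow> s \<le> m') \<longrightarrow> m \<le> m')"

text \<open>
  The midpoint of the leftmost component of \<open>{s. Q s}\<close>, when that set is a nonempty bounded finite
  union of intervals. The component may be a single point, whence the \<open>m \<le> c\<close>.
\<close>

definition leftmost_midpoint :: "(real \<Rightarrow> bool) \<Rightarrow> real \<Rightarrow> bool" where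
  "leftmost_midpoint Q t \<longleftrightarrow> (\<exists>m M. is_inf Q m \<and>
     is_sup (\<lambda>c. m \<le> c \<and> (\<forall>s. m < s \<and> s < c \<longrightarrow> Q s)) M \<and> t + t = m + M)"

lemma is_inf_unique: "is_inf Q m \<Longrightarrow> is_inf Q m' \<Longrightarrow> m = m'"
  unfolding is_inf_def by (intro antisym) simp_all

lemma is_sup_unique: "is_sup Q m \<Longrightarrow> is_sup Q m' \<Longrightarrow> m = m'"
  unfolding is_sup_def by (intro antisym) simp_all

lemma ex_is_inf:
  assumes "Q s" "\<And>s. Q s \<Longrightarrow> b \<le> s"
  shows "\<exists>m. is_inf Q m"
proof -
  have "bdd_below {s. Q s}" using assms(2) by (intro bdd_belowI[of _ b]) simp
  then have "is_inf Q (Inf {s. Q s})"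
    unfolding is_inf_def using assms(1) by (auto intro: cInf_lower cInf_greatest)
  then show ?thesis ..
qed

lemma ex_is_sup:
  assumes "Q s" "\<And>s. Q s \<Longrightarrow> s \<le> b"
  shows "\<exists>m. is_sup Q m"
proof -
  have "bdd_above {s. Q s}" using assms(2) by (intro bdd_aboveI[of _ b]) simp
  then have "is_sup Q (Sup {s. Q s})"
    unfolding is_sup_def using assms(1) by (auto intro: cSup_upper cSup_least)
  then show ?thesis ..
qed

lemma leftmost_midpoint_unique:
  assumes "leftmost_midpoint Q s" "leftmost_midpoint Q t"
  shows "s = t"
proof -
  obtain m M where m: "is_inf Q m" and M: "is_sup (\<lambda>c. m \<le> c \<and> (\<forall>s. m < s \<and> s < c \<longrightarrow> Q s)) M"
    and s: "s + s = m + M"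
    using assms(1) unfolding leftmost_midpoint_def by blast
  obtain m' M' where m': "is_inf Q m'" and M': "is_sup (\<lambda>c. m' \<le> c \<and> (\<forall>s. m' < s \<and> s < c \<longrightarrow> Q s)) M'"
    and t: "t + t = m' + M'"
    using assms(2) unfolding leftmost_midpoint_def by blast
  have "m' = m" using is_inf_unique[OF m' m] .
  with M' have "M' = M" using is_sup_unique[OF _ M] by simp
  with \<open>m' = m\<close> s t show ?thesis by simp
qed

text \<open>The inequality says that \<open>ln g - K * L\<close> has nonpositive derivative. Going
  down to 0 this function does not decrease, so for bounded \<open>L\<close> the logarithm of
  \<open>g\<close> cannot tend to minus infinity.\<close>

lemma log_growth_contradiction:
  fixes g L :: "real \<Rightarrow> real"
  assumes pos: "\<forall>\<^sub>F t in at_right 0. 0 < g t"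
    and deriv: "\<forall>\<^sub>F t in at_right 0. \<exists>g' L'. (g has_real_derivative g') (at t) \<and>
      (L has_real_derivative L') (at t) \<and> g' \<le> K * g t * L'"
    and bounded: "\<forall>\<^sub>F t in at_right 0. \<bar>L t\<bar> \<le> B"
    and lim: "(g \<longlongrightarrow> 0) (at_right 0)"
  shows False
proof -
  let ?h = "\<lambda>t. ln (g t) - K * L t"
  obtain b where b: "0 < b" and P: "\<And>t. 0 < t \<Longrightarrow> t < b \<Longrightarrow> 0 < g t \<and>
      (\<exists>g' L'. (g has_real_derivative g') (at t) \<and> (L has_real_derivative L') (at t) \<and> g' \<le> K * g t * L') \<and> \<bar>L t\<bar> \<le> B"
    using eventually_conj[OF pos eventually_conj[OF deriv bounded]]
    unfolding eventually_at_right_field by blast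
  define t1 where "t1 = b / 2"
  have t1: "0 < t1" "t1 < b" using b by (simp_all add: t1_def)
  have mono: "?h t1 \<le> ?h t" if t: "0 < t" "t \<le> t1" for t
  proof (rule DERIV_nonpos_imp_nonincreasing[OF t(2)])
    fix s assume s: "t \<le> s" "s \<le> t1"
    then have s': "0 < s" "s < b" using t t1 by simp_all
    obtain g' L' where d: "(g has_real_derivative g') (at s)" "(L has_real_derivative L') (at s)"
      and le: "g' \<le> K * g s * L'"
      using P[OF s'] by blast
    have g: "0 < g s" using P[OF s'] by blast
    have "((\<lambda>t. ln (g t)) has_real_derivative 1 / g s * g') (at s)"
      by (rule DERIV_chain2[where f = ln and g = g, OF DERIV_ln_divide[OF g] d(1)])
    then have "(?h has_real_derivative 1 / g s * g' - K * L') (at s)"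
      by (intro DERIV_diff DERIV_cmult d)
    moreover have "1 / g s * g' - K * L' \<le> 0"
      using le g by (simp add: divide_le_eq mult_ac)
    ultimately show "\<exists>y. (?h has_real_derivative y) (at s) \<and> y \<le> 0" by blast
  qed
  \<comment> \<open>The lower bound that monotonicity and the bound on \<open>L\<close> force upon
    \<open>g\<close> throughout \<open>(0, t1]\<close>.\<close>
  define c where "c = exp (?h t1 - \<bar>K\<bar> * B)"
  have "c > 0" by (simp add: c_def)
  then have "\<forall>\<^sub>F t in at_right 0. g t < c" using order_tendstoD(2)[OF lim] by blast
  then obtain d where d: "0 < d" "\<And>t. 0 < t \<Longrightarrow> t < d \<Longrightarrow> g t < c"
    unfolding eventually_at_right_field by blast
  define t where "t = min (d / 2) t1"
  have t: "0 < t" "t \<le> t1" "t < d" using d(1) t1 by (auto simp: t_def)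
  have g: "0 < g t" "\<bar>L t\<bar> \<le> B" using P[of t] t t1 by auto
  have "- (K * L t) \<le> \<bar>K\<bar> * \<bar>L t\<bar>" by (simp add: abs_mult[symmetric])
  also have "\<dots> \<le> \<bar>K\<bar> * B" using g(2) by (rule mult_left_mono) simp
  finally have KL: "- (K * L t) \<le> \<bar>K\<bar> * B" .
  have "ln (g t) < ln c" using d(2)[OF t(1,3)] g(1) \<open>c > 0\<close> by simp
  also have "ln c = ?h t1 - \<bar>K\<bar> * B" by (simp add: c_def)
  also have "\<dots> \<le> ?h t - \<bar>K\<bar> * B" using mono[OF t(1,2)] by simp
  finally show False using KL by simp
qed

section \<open>Frechet and limiting normals: velocities, locality and the gap of cones\<close>

text \<open>The curve stays in \<open>X\<close> on both sides of \<open>t\<close>. Moving forwards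
  gives \<open>v \<bullet> l \<le> 0\<close>, moving backwards the opposite inequality.\<close>

lemma frechet_normal_orthogonal_velocity:
  fixes x :: "real \<Rightarrow> 'a::euclidean_space"
  assumes v: "v \<in> frechet_normal_cone X (x t)"
    and X: "\<forall>\<^sub>F s in at t. x s \<in> X"
    and d: "(x has_vector_derivative l) (at t)"
  shows "v \<bullet> l = 0"
proof -
  \<comment> \<open>Errors per unit of \<open>\<bar>s - t\<bar>\<close>: the first summand is the
    tolerance in the normal inequality, using
    \<open>norm (x s - x t) \<le> \<bar>s - t\<bar> * (norm l + e)\<close>; the second is the
    remainder of the first-order expansion of \<open>x\<close>. Both vanish with
    \<open>e\<close>.\<close>
  have le: "\<bar>v \<bullet> l\<bar> \<le> e * (norm l + e) + norm v * e" if e: "e > 0" for e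
  proof -
    have "\<forall>\<^sub>F y in at (x t) within X. v \<bullet> (y - x t) \<le> e * norm (y - x t)"
      using v e unfolding frechet_normal_cone_def by blast
    then obtain r where r: "r > 0"
      and le: "\<And>y. y \<in> X \<Longrightarrow> y \<noteq> x t \<Longrightarrow> dist y (x t) < r \<Longrightarrow> v \<bullet> (y - x t) \<le> e * norm (y - x t)"
      unfolding eventually_at by blast
    have "(x \<longlongrightarrow> x t) (at t)"
      using has_vector_derivative_continuous[OF d] by (simp add: isCont_def continuous_at)
    then have "\<forall>\<^sub>F s in at t. dist (x s) (x t) < r"
      using r by (rule tendstoD)
    then have normal: "\<forall>\<^sub>F s in at t. v \<bullet> (x s - x t) \<le> e * norm (x s - x t)"
      using X
    proof eventually_elim
      case (elim s)
      then show ?case using le[of "x s"] by (cases "x s = x t") auto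
    qed
    obtain r' where r': "r' > 0"
      and approx: "\<And>s. norm (s - t) < r' \<Longrightarrow> norm (x s - x t - (s - t) *\<^sub>R l) \<le> e * norm (s - t)"
      using d e unfolding has_vector_derivative_def has_derivative_at_alt by blast
    have both: "\<forall>\<^sub>F s in at t. (s - t) * (v \<bullet> l) \<le> \<bar>s - t\<bar> * (e * (norm l + e) + norm v * e)"
    proof -
      have "\<forall>\<^sub>F s in at t. dist s t < r'" using r' by (rule eventually_at_ball'[unfolded mem_ball, THEN eventually_mono]) (auto simp: dist_commute)
      with normal show ?thesis
      proof eventually_elim
        case (elim s)
        let ?R = "x s - x t - (s - t) *\<^sub>R l"
        have R: "norm ?R \<le> e * \<bar>s - t\<bar>" using approx[of s] elim(2) by (simp add: dist_norm)
        have tri: "norm (x s - x t) \<le> norm ((s - t) *\<^sub>R l) + norm ?R"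
          using norm_triangle_ineq[of "(s - t) *\<^sub>R l" ?R] by simp
        have N: "norm (x s - x t) \<le> \<bar>s - t\<bar> * (norm l + e)"
        proof -
          have "norm ((s - t) *\<^sub>R l) = \<bar>s - t\<bar> * norm l" by (rule norm_scaleR[unfolded real_norm_def])
          moreover have "\<bar>s - t\<bar> * (norm l + e) = \<bar>s - t\<bar> * norm l + e * \<bar>s - t\<bar>"
            by (simp add: distrib_left mult.commute)
          ultimately show ?thesis using R tri by linarith
        qed
        have "- (v \<bullet> ?R) \<le> norm v * norm ?R"
          using Cauchy_Schwarz_ineq2[of v ?R] by linarith
        also have "\<dots> \<le> norm v * (e * \<bar>s - t\<bar>)"
          using R by (rule mult_left_mono) simp
        finally have "(s - t) * (v \<bullet> l) \<le> v \<bullet> (x s - x t) + norm v * (e * \<bar>s - t\<bar>)"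
          by (simp add: inner_diff_right)
        also have "v \<bullet> (x s - x t) \<le> e * (\<bar>s - t\<bar> * (norm l + e))"
          using elim(1) mult_left_mono[OF N, of e] e by linarith
        finally show ?case by (simp add: algebra_simps)
      qed
    qed
    let ?c = "e * (norm l + e) + norm v * e"
    have "\<exists>s>t. (s - t) * (v \<bullet> l) \<le> \<bar>s - t\<bar> * ?c"
    proof -
      have "\<forall>\<^sub>F s in at_right t. (s - t) * (v \<bullet> l) \<le> \<bar>s - t\<bar> * ?c"
        using both by (simp add: eventually_at_split)
      then obtain b where "t < b" "\<And>s. t < s \<Longrightarrow> s < b \<Longrightarrow> (s - t) * (v \<bullet> l) \<le> \<bar>s - t\<bar> * ?c"
        unfolding eventually_at_right_field by blast
      then show ?thesis using dense[of t b] by blast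
    qed
    then have "v \<bullet> l \<le> ?c" by (auto simp: mult_le_cancel_left)
    moreover have "\<exists>s<t. (s - t) * (v \<bullet> l) \<le> \<bar>s - t\<bar> * ?c"
    proof -
      have "\<forall>\<^sub>F s in at_left t. (s - t) * (v \<bullet> l) \<le> \<bar>s - t\<bar> * ?c"
        using both by (simp add: eventually_at_split)
      then obtain b where "b < t" "\<And>s. b < s \<Longrightarrow> s < t \<Longrightarrow> (s - t) * (v \<bullet> l) \<le> \<bar>s - t\<bar> * ?c"
        unfolding eventually_at_left_field by blast
      then show ?thesis using dense[of b t] by blast
    qed
    then obtain s where s: "s < t" "(s - t) * (v \<bullet> l) \<le> \<bar>s - t\<bar> * ?c" by blast
    then have "(t - s) * (- (v \<bullet> l)) \<le> (t - s) * ?c" by (simp add: algebra_simps)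
    then have "- (v \<bullet> l) \<le> ?c" using s(1) by (simp only: mult_le_cancel_left)
    ultimately show ?thesis by linarith
  qed
  have "((\<lambda>e. e * (norm l + e) + norm v * e) \<longlongrightarrow> 0 * (norm l + 0) + norm v * 0) (at_right 0)"
    by (intro tendsto_intros)
  then have "((\<lambda>e. e * (norm l + e) + norm v * e) \<longlongrightarrow> 0) (at_right 0)" by simp
  moreover have "\<forall>\<^sub>F e in at_right 0. \<bar>v \<bullet> l\<bar> \<le> e * (norm l + e) + norm v * e"
    using le by (intro eventually_at_rightI[of 0 1]) auto
  ultimately have "\<bar>v \<bullet> l\<bar> \<le> 0"
    by (intro tendsto_lowerbound) auto
  then show ?thesis by simp
qed

lemma frechet_normal_cone_Int_open:
  assumes "open U" "x \<in> U"
  shows "frechet_normal_cone (Q \<inter> U) x = frechet_normal_cone Q x"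
proof -
  have "at x within Q \<inter> U = at x within Q"
    by (rule at_within_nhd[OF assms(2,1)]) simp
  then show ?thesis unfolding frechet_normal_cone_def by simp
qed

text \<open>A sequence tending to a point of \<open>U\<close> has a tail in \<open>U\<close>, and a
  shift of the index discards the rest. Neighbourhoods can thus be shrunk without changing the
  cones.\<close>

lemma limiting_normal_cone_Int_open:
  assumes "open U" "x \<in> U"
  shows "limiting_normal_cone (Q \<inter> U) x = limiting_normal_cone Q x"
proof
  show "limiting_normal_cone (Q \<inter> U) x \<subseteq> limiting_normal_cone Q x"
  proof
    fix v assume "v \<in> limiting_normal_cone (Q \<inter> U) x"
    then obtain xs vs where h: "\<And>i::nat. xs i \<in> Q \<inter> U \<and> vs i \<in> frechet_normal_cone (Q \<inter> U) (xs i)"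
      and "xs \<longlonglongrightarrow> x" "vs \<longlonglongrightarrow> v"
      unfolding limiting_normal_cone_def by blast
    moreover have "xs i \<in> Q \<and> vs i \<in> frechet_normal_cone Q (xs i)" for i
      using h[of i] frechet_normal_cone_Int_open[OF assms(1), of "xs i" Q] by simp
    ultimately show "v \<in> limiting_normal_cone Q x"
      unfolding limiting_normal_cone_def by blast
  qed
  show "limiting_normal_cone Q x \<subseteq> limiting_normal_cone (Q \<inter> U) x"
  proof
    fix v assume "v \<in> limiting_normal_cone Q x"
    then obtain xs vs where h: "\<And>i::nat. xs i \<in> Q \<and> vs i \<in> frechet_normal_cone Q (xs i)"
      and lim: "xs \<longlonglongrightarrow> x" "vs \<longlonglongrightarrow> v"
      unfolding limiting_normal_cone_def by blast
    have "\<forall>\<^sub>F i in sequentially. xs i \<in> U"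
      using topological_tendstoD[OF lim(1) assms] .
    then obtain n where n: "\<And>i. i \<ge> n \<Longrightarrow> xs i \<in> U"
      unfolding eventually_sequentially by blast
    have "xs (i + n) \<in> Q \<inter> U \<and> vs (i + n) \<in> frechet_normal_cone (Q \<inter> U) (xs (i + n))" for i
      using h[of "i + n"] n[of "i + n"] frechet_normal_cone_Int_open[OF assms(1), of "xs (i + n)" Q] by simp
    moreover have "(\<lambda>i. xs (i + n)) \<longlonglongrightarrow> x" "(\<lambda>i. vs (i + n)) \<longlonglongrightarrow> v"
      using lim by (simp_all add: LIMSEQ_ignore_initial_segment)
    ultimately show "v \<in> limiting_normal_cone (Q \<inter> U) x"
      unfolding limiting_normal_cone_def mem_Collect_eq
      by (intro exI[of _ "\<lambda>i. xs (i + n)"] exI[of _ "\<lambda>i. vs (i + n)"]) simp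
  qed
qed

lemma zero_in_limiting_normal_cone: "x \<in> Q \<Longrightarrow> 0 \<in> limiting_normal_cone Q x"
proof -
  assume "x \<in> Q"
  moreover have "0 \<in> frechet_normal_cone Q x"
    unfolding frechet_normal_cone_def by simp
  ultimately show ?thesis
    unfolding limiting_normal_cone_def mem_Collect_eq
    by (intro exI[of _ "\<lambda>_. x"] exI[of _ "\<lambda>_. 0"]) simp
qed

text \<open>A real supremum bounds its members only if they are bounded above; here
  \<open>0 \<in> V\<close> keeps the distance of a unit vector at most 1.\<close>

lemma infdist_le_cone_gap:
  fixes U V :: "'a::euclidean_space set"
  assumes "u \<in> U" "norm u = 1" "0 \<in> V"
  shows "infdist u V \<le> cone_gap U V"
proof -
  have "bdd_above ((\<lambda>u. infdist u V) ` {u \<in> U. norm u = 1})"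
  proof (rule bdd_aboveI2)
    fix u assume "u \<in> {u \<in> U. norm u = 1}"
    then show "infdist u V \<le> 1" using infdist_le[OF assms(3), of u] by simp
  qed
  then have "infdist u V \<le> (SUP u \<in> {u \<in> U. norm u = 1}. infdist u V)"
    using assms by (intro cSUP_upper) simp_all
  moreover have "\<exists>u\<in>U. norm u = 1" using assms by blast
  ultimately show ?thesis by (simp add: cone_gap_def)
qed

section \<open>Definable choice\<close>

context o_minimal_structure
begin

text \<open>Parameters may be frozen because constant maps are definable, polynomials having
  arbitrary real coefficients.\<close>

lemma dpred_slice:
  assumes "dpred (\<lambda>w. P (fst w) (snd w))"
  shows "dpred (P z)"
  using dpred_comp[OF assms dmap_Pair[OF dmap_const[of z] dmap_ident]] by simp

text \<open>If \<open>m < M\<close>, the midpoint is interior to an interval on which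
  \<open>Q\<close> holds. If \<open>m = M\<close>, the germ of \<open>Q\<close> to the right of
  \<open>m\<close> must be false, so \<open>Q\<close> fails on some \<open>(m, b)\<close>; then
  \<open>Q m\<close> holds, as otherwise the infimum would be at least \<open>b\<close>.\<close>

lemma leftmost_midpoint_mem:
  assumes Q: "dpred Q" and ne: "Q s" and bd: "\<And>s. Q s \<Longrightarrow> \<bar>s\<bar> \<le> B"
  shows "\<exists>t. leftmost_midpoint Q t \<and> Q t"
proof -
  obtain m where m: "is_inf Q m"
    using ex_is_inf[where Q = Q and s = s and b = "- B"] ne bd by (metis abs_le_iff minus_le_iff)
  let ?C = "\<lambda>c. m \<le> c \<and> (\<forall>s. m < s \<and> s < c \<longrightarrow> Q s)"
  have mB: "m \<le> B" using m ne bd[OF ne] unfolding is_inf_def by force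
  have "c \<le> B" if "?C c" for c
  proof (rule ccontr)
    assume "\<not> c \<le> B"
    then obtain s where "B < s" "s < c" using dense[of B c] by auto
    then have "Q s" using that mB by simp
    then show False using bd[of s] \<open>B < s\<close> by simp
  qed
  moreover have Cm: "?C m" by auto
  ultimately obtain M where M: "is_sup ?C M" using ex_is_sup[of ?C m B] by blast
  have "m \<le> M" using M Cm unfolding is_sup_def by blast
  let ?t = "(m + M) / 2"
  have "Q ?t"
  proof (cases "m = M")
    case False
    then have lt: "m < ?t" "?t < M" using \<open>m \<le> M\<close> by simp_all
    then have "\<not> (\<forall>c. ?C c \<longrightarrow> c \<le> ?t)" using M unfolding is_sup_def by (meson not_le)
    then obtain c where "?C c" "?t < c" by (auto simp: not_le)
    then show ?thesis using lt(1) by blast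
  next
    case True
    have "\<not> (\<forall>\<^sub>F s in at_right m. Q s)"
    proof
      assume "\<forall>\<^sub>F s in at_right m. Q s"
      then obtain b where b: "m < b" "\<And>s. m < s \<Longrightarrow> s < b \<Longrightarrow> Q s"
        unfolding eventually_at_right_field by blast
      then have "?C b" by simp
      then have "b \<le> M" using M unfolding is_sup_def by blast
      then show False using b(1) True by simp
    qed
    then have "\<forall>\<^sub>F s in at_right m. \<not> Q s" using dpred_germ[OF Q] by blast
    then obtain b where b: "m < b" "\<And>s. m < s \<Longrightarrow> s < b \<Longrightarrow> \<not> Q s"
      unfolding eventually_at_right_field by blast
    have "Q m"
    proof (rule ccontr)
      assume "\<not> Q m"
      have "b \<le> s" if "Q s" for s
      proof -
        have "m \<le> s" using m that unfolding is_inf_def by blast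
        moreover have "s \<noteq> m" using that \<open>\<not> Q m\<close> by blast
        ultimately show ?thesis using b(2)[of s] that by force
      qed
      then have "b \<le> m" using m unfolding is_inf_def by blast
      with b(1) show False by simp
    qed
    then show ?thesis using True by simp
  qed
  moreover have "leftmost_midpoint Q ?t"
    unfolding leftmost_midpoint_def using m M by (intro exI[of _ m] exI[of _ M] conjI) simp_all
  ultimately show ?thesis by blast
qed

lemma dpred_leftmost_midpoint:
  assumes "dpred (\<lambda>w. R (fst w) (snd w))" and "dmap T" and "dmap S"
  shows "dpred (\<lambda>z. leftmost_midpoint (R (S z)) (T z))"
proof -
  have R: "dpred (\<lambda>z. R (f z) (g z))" if "dmap f" "dmap g" for f :: "'z::euclidean_space \<Rightarrow> 'a" and g
    using dpred_comp[OF assms(1) dmap_Pair[OF that]] by simp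
  show ?thesis
    unfolding leftmost_midpoint_def is_inf_def is_sup_def
    by (intro dpred_intros R dmap_comp[OF assms(2)] dmap_comp[OF assms(3)] dmap_intros)
qed

text \<open>The fibres are shrunk one coordinate at a time, each coordinate being fixed at the
  leftmost midpoint of its possible values. When all coordinates are fixed, each fibre over
  \<open>t > 0\<close> is a single point. Bounded fibres guarantee the infimum and supremum behind
  the midpoint.\<close>

lemma definable_choice:
  fixes A :: "real \<Rightarrow> 'a::euclidean_space \<Rightarrow> bool"
  assumes A: "dpred (\<lambda>w. A (fst w) (snd w))"
    and ne: "\<And>t. 0 < t \<Longrightarrow> \<exists>x. A t x"
    and bd: "\<And>t x. A t x \<Longrightarrow> norm x \<le> B"
  shows "\<exists>\<gamma>. dmap \<gamma> \<and> (\<forall>t>0. A t (\<gamma> t))"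
proof -
  \<comment> \<open>\<open>C\<close> is the set of coordinates already fixed: all points of a fibre
    of \<open>A'\<close> agree in them.\<close>
  have "\<exists>A'. dpred (\<lambda>w. A' (fst w) (snd w)) \<and> (\<forall>t x. A' t x \<longrightarrow> A t x) \<and> (\<forall>t>0. \<exists>x. A' t x) \<and>
      (\<forall>t x y. A' t x \<longrightarrow> A' t y \<longrightarrow> (\<forall>b\<in>C. x \<bullet> b = y \<bullet> b))"
    if "finite C" "C \<subseteq> Basis" for C :: "'a set"
    using that
  proof (induction C rule: finite_induct)
    case empty
    then show ?case using A ne by (intro exI[of _ A]) simp
  next
    case (insert b C)
    from insert.prems have "C \<subseteq> Basis" by simp
    from insert.IH[OF this] obtain A' where A': "dpred (\<lambda>w. A' (fst w) (snd w))"
      and sub: "\<forall>t x. A' t x \<longrightarrow> A t x" and ne': "\<forall>t>0. \<exists>x. A' t x"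
      and C: "\<forall>t x y. A' t x \<longrightarrow> A' t y \<longrightarrow> (\<forall>b\<in>C. x \<bullet> b = y \<bullet> b)"
      by (elim exE conjE) (rule that)
    \<comment> \<open>The values of the coordinate \<open>b\<close> on the fibre over
      \<open>t\<close>.\<close>
    define R where "R t s \<longleftrightarrow> (\<exists>x. A' t x \<and> x \<bullet> b = s)" for t s
    define A'' where "A'' t x \<longleftrightarrow> A' t x \<and> leftmost_midpoint (R t) (x \<bullet> b)" for t x
    have R: "dpred (\<lambda>w. R (fst w) (snd w))"
      unfolding R_def
      using dpred_comp[OF A' dmap_Pair[OF dmap_fst[OF dmap_fst[OF dmap_ident]] dmap_snd[OF dmap_ident]]]
      by (intro dpred_ex dpred_conj dpred_eq dmap_intros) simp
    have "dpred (\<lambda>w. A'' (fst w) (snd w))"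
      unfolding A''_def by (intro dpred_conj A' dpred_leftmost_midpoint[OF R] dmap_intros)
    moreover have "\<exists>x. A'' t x" if t: "0 < t" for t
    proof -
      obtain x where x: "A' t x" using ne' t by blast
      have "\<bar>s\<bar> \<le> B" if "R t s" for s
      proof -
        obtain z where z: "A' t z" "z \<bullet> b = s" using \<open>R t s\<close> unfolding R_def by blast
        have "\<bar>z \<bullet> b\<bar> \<le> norm z" using insert.prems by (intro Basis_le_norm) simp
        with bd[OF sub[rule_format, OF z(1)]] z(2) show ?thesis by simp
      qed
      moreover have "R t (x \<bullet> b)" unfolding R_def using x by blast
      ultimately obtain s where s: "leftmost_midpoint (R t) s" "R t s"
        using leftmost_midpoint_mem[OF dpred_slice[OF R]] by blast
      then obtain z where "A' t z" "z \<bullet> b = s" unfolding R_def by blast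
      with s(1) show ?thesis unfolding A''_def by blast
    qed
    moreover have "\<forall>b\<in>insert b C. x \<bullet> b = y \<bullet> b" if "A'' t x" "A'' t y" for t x y
      using that C leftmost_midpoint_unique[of "R t" "x \<bullet> b" "y \<bullet> b"] unfolding A''_def by blast
    moreover have "A t x" if "A'' t x" for t x
      using that sub unfolding A''_def by blast
    ultimately show ?case by (intro exI[of _ A''] conjI allI impI)
  qed
  from this[OF finite_Basis order_refl]
  obtain A' where A': "dpred (\<lambda>w. A' (fst w) (snd w))"
    and sub: "\<forall>t x. A' t x \<longrightarrow> A t x" and ne': "\<forall>t>0. \<exists>x. A' t x"
    and comp: "\<forall>t x y. A' t x \<longrightarrow> A' t y \<longrightarrow> (\<forall>b\<in>Basis. x \<bullet> b = y \<bullet> b)"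
    by (elim exE conjE) (rule that)
  have unique: "x = y" if "A' t x" "A' t y" for t x y
    by (rule euclidean_eqI) (use comp that in blast)
  \<comment> \<open>The value 0 for \<open>t \<le> 0\<close> makes the selection total while keeping
    its graph definable.\<close>
  define \<gamma> where "\<gamma> t = (if 0 < t then THE x. A' t x else 0)" for t :: real
  have \<gamma>: "A' t (\<gamma> t)" if t: "0 < t" for t
  proof -
    obtain x where x: "A' t x" using ne' t by blast
    then have "A' t (THE x. A' t x)" by (rule theI) (rule unique[OF _ x])
    with t show ?thesis by (simp add: \<gamma>_def)
  qed
  have "dpred (\<lambda>w. (0 < fst w \<and> A' (fst w) (snd w)) \<or> (\<not> 0 < fst w \<and> snd w = 0))"
    by (intro dpred_intros A' dmap_intros)
  moreover have "((0 < t \<and> A' t x) \<or> (\<not> 0 < t \<and> x = 0)) \<longleftrightarrow> x = \<gamma> t" for t x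
  proof (cases "0 < t")
    case True
    then show ?thesis using \<gamma>[OF True] unique[of t x "\<gamma> t"] by auto
  qed (simp add: \<gamma>_def)
  ultimately have "dmap \<gamma>" by (intro dmap_graphI) simp
  moreover have "\<forall>t>0. A t (\<gamma> t)" using sub \<gamma> by blast
  ultimately show ?thesis by blast
qed

section \<open>Limits and signs of derivatives of definable curves\<close>

lemma dmap_bounded_limit_real:
  fixes f :: "real \<Rightarrow> real"
  assumes f: "dmap f" and bd: "\<forall>\<^sub>F t in at_right c. \<bar>f t\<bar> \<le> K"
  shows "\<exists>l. (f \<longlongrightarrow> l) (at_right c)"
proof -
  have "dpred (\<lambda>t. r < f t)" for r
    by (intro dpred_less dmap_const f)
  then obtain l where l: "((\<lambda>t. ereal (f t)) \<longlongrightarrow> l) (at_right c)"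
    using ex_ereal_limit[where F = "at_right c" and g = f] dpred_germ by blast
  have "l \<le> ereal K"
    by (rule tendsto_upperbound[OF l]) (use bd in \<open>auto elim!: eventually_mono\<close>)
  moreover have "ereal (- K) \<le> l"
    by (rule tendsto_lowerbound[OF l]) (use bd in \<open>auto elim!: eventually_mono\<close>)
  ultimately obtain r where "l = ereal r" by (cases l) auto
  with l show ?thesis by auto
qed

lemma dmap_bounded_limit:
  fixes f :: "real \<Rightarrow> 'a::euclidean_space"
  assumes f: "dmap f" and bd: "\<forall>\<^sub>F t in at_right c. norm (f t) \<le> K"
  shows "\<exists>l. (f \<longlongrightarrow> l) (at_right c)"
proof -
  have "\<exists>l. ((\<lambda>t. f t \<bullet> b) \<longlongrightarrow> l) (at_right c)" if "b \<in> Basis" for b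
  proof (rule dmap_bounded_limit_real)
    show "dmap (\<lambda>t. f t \<bullet> b)" by (intro dmap_inner_const f)
    show "\<forall>\<^sub>F t in at_right c. \<bar>f t \<bullet> b\<bar> \<le> K"
      using bd by (rule eventually_mono) (rule order_trans[OF Basis_le_norm[OF that]])
  qed
  then obtain l where "\<And>b. b \<in> Basis \<Longrightarrow> ((\<lambda>t. f t \<bullet> b) \<longlongrightarrow> l b) (at_right c)" by metis
  then have "(f \<longlongrightarrow> (\<Sum>b\<in>Basis. l b *\<^sub>R b)) (at_right c)"
    by (subst tendsto_componentwise_iff) simp
  then show ?thesis ..
qed

lemma eventually_vector_differentiable:
  fixes f :: "real \<Rightarrow> 'a::euclidean_space"
  assumes f: "dmap f"
  shows "\<forall>\<^sub>F t in at_right c. \<exists>l. (f has_vector_derivative l) (at t)"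
proof -
  have "\<forall>\<^sub>F t in at_right c. \<forall>b\<in>Basis. \<exists>l. ((\<lambda>t. f t \<bullet> b) has_real_derivative l) (at t)"
    by (intro eventually_ball_finite finite_Basis ballI eventually_differentiable dmap_inner_const f)
  then show ?thesis
  proof (rule eventually_mono)
    fix t assume "\<forall>b\<in>Basis. \<exists>l. ((\<lambda>t. f t \<bullet> b) has_real_derivative l) (at t)"
    then obtain l where l: "\<And>b. b \<in> Basis \<Longrightarrow> ((\<lambda>t. f t \<bullet> b) has_real_derivative l b) (at t)" by metis
    have "(f has_vector_derivative (\<Sum>b\<in>Basis. l b *\<^sub>R b)) (at t)"
      unfolding has_vector_derivative_def
      by (subst has_derivative_componentwise_within)
        (use l in \<open>simp add: has_field_derivative_def mult_commute_abs\<close>)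
    then show "\<exists>l. (f has_vector_derivative l) (at t)" ..
  qed
qed

text \<open>Applied to a difference, this carries an inequality between germs that vanish at 0 over
  to their derivatives. Otherwise the derivative would be negative on some \<open>(0, b)\<close> by
  the dichotomy, and a decreasing function with limit 0 at 0 becomes negative.\<close>

lemma eventually_deriv_nonneg:
  fixes f :: "real \<Rightarrow> real"
  assumes f: "dmap f" and nonneg: "\<forall>\<^sub>F t in at_right 0. 0 \<le> f t" and lim: "(f \<longlongrightarrow> 0) (at_right 0)"
  shows "\<forall>\<^sub>F t in at_right 0. \<forall>l. (f has_real_derivative l) (at t) \<longrightarrow> 0 \<le> l"
proof -
  have "dpred (\<lambda>t. \<exists>l. (f has_real_derivative l) (at t) \<and> l < 0)"
    by (intro dpred_intros dpred_has_real_derivative[OF f] dmap_intros)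
  then consider "\<forall>\<^sub>F t in at_right 0. \<exists>l. (f has_real_derivative l) (at t) \<and> l < 0"
    | "\<forall>\<^sub>F t in at_right 0. \<not> (\<exists>l. (f has_real_derivative l) (at t) \<and> l < 0)"
    using dpred_germ by blast
  then show ?thesis
  proof cases
    case 1
    obtain b where b: "0 < b"
      and P: "\<And>t. 0 < t \<Longrightarrow> t < b \<Longrightarrow> (\<exists>l. (f has_real_derivative l) (at t) \<and> l < 0) \<and> 0 \<le> f t"
      using eventually_conj[OF 1 nonneg] unfolding eventually_at_right_field by blast
    have dec: "f t < f s" if "0 < s" "s < t" "t < b" for s t
      by (rule DERIV_neg_imp_decreasing[OF that(2)]) (use P that in \<open>meson less_le_trans le_less_trans\<close>)
    have "\<forall>\<^sub>F u in at_right 0. f (b / 4) \<le> f u"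
    proof (rule eventually_at_rightI[of 0 "b / 4"])
      fix u assume "u \<in> {0<..<b / 4}"
      then show "f (b / 4) \<le> f u" using dec[of u "b / 4"] b by simp
    qed (use b in simp)
    then have "f (b / 4) \<le> 0"
      by (rule tendsto_lowerbound[OF lim]) simp
    \<comment> \<open>The limit yields only \<open>f (b / 4) \<le> 0\<close>; strict decrease up to
      a second point makes the value there negative.\<close>
    moreover have "f (b / 2) < f (b / 4)" "0 \<le> f (b / 2)"
      using dec[of "b / 4" "b / 2"] P[of "b / 2"] b by simp_all
    ultimately show ?thesis by simp
  next
    case 2
    then show ?thesis by (rule eventually_mono) (meson not_le)
  qed
qed

text \<open>With a constant sign, \<open>\<bar>l\<bar>\<close> is linear in the derivative. A sum of
  absolute values of velocities then has an explicit primitive, without integration.\<close>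

lemma eventually_deriv_sign:
  fixes f :: "real \<Rightarrow> real"
  assumes f: "dmap f"
  shows "\<exists>\<sigma>. \<bar>\<sigma>\<bar> = 1 \<and> (\<forall>\<^sub>F t in at_right c. \<forall>l. (f has_real_derivative l) (at t) \<longrightarrow> \<bar>l\<bar> = \<sigma> * l)"
proof -
  have "dpred (\<lambda>t. \<exists>l. (f has_real_derivative l) (at t) \<and> 0 \<le> l)"
    by (intro dpred_intros dpred_has_real_derivative[OF f] dmap_intros)
  then consider "\<forall>\<^sub>F t in at_right c. \<exists>l. (f has_real_derivative l) (at t) \<and> 0 \<le> l"
    | "\<forall>\<^sub>F t in at_right c. \<not> (\<exists>l. (f has_real_derivative l) (at t) \<and> 0 \<le> l)"
    using dpred_germ by blast
  then show ?thesis
  proof cases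
    case 1
    have "\<forall>\<^sub>F t in at_right c. \<forall>l. (f has_real_derivative l) (at t) \<longrightarrow> \<bar>l\<bar> = 1 * l"
      using 1
    proof (rule eventually_mono, intro allI impI)
      fix t l assume "\<exists>l. (f has_real_derivative l) (at t) \<and> 0 \<le> l" and l: "(f has_real_derivative l) (at t)"
      then obtain l' where "(f has_real_derivative l') (at t)" "0 \<le> l'" by blast
      with DERIV_unique[OF l] show "\<bar>l\<bar> = 1 * l" by simp
    qed
    then show ?thesis by (intro exI[of _ 1]) simp
  next
    case 2
    have "\<forall>\<^sub>F t in at_right c. \<forall>l. (f has_real_derivative l) (at t) \<longrightarrow> \<bar>l\<bar> = - 1 * l"
      using 2
    proof (rule eventually_mono, intro allI impI)
      fix t l assume "\<not> (\<exists>l. (f has_real_derivative l) (at t) \<and> 0 \<le> l)" and "(f has_real_derivative l) (at t)"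
      then have "\<not> 0 \<le> l" by blast
      then show "\<bar>l\<bar> = - 1 * l" by simp
    qed
    then show ?thesis by (intro exI[of _ "-1"]) simp
  qed
qed

end

section \<open>Strong (a)-regularity implies (b)-regularity\<close>

lemma has_real_derivative_inner_right:
  fixes f :: "real \<Rightarrow> 'a::real_inner"
  assumes "(f has_vector_derivative l) (at t)"
  shows "((\<lambda>s. f s \<bullet> c) has_real_derivative l \<bullet> c) (at t)"
  using bounded_linear.has_vector_derivative[OF bounded_linear_inner_left assms]
  by (simp add: has_real_derivative_iff_has_vector_derivative)

context o_minimal_structure
begin

text \<open>No smoothness is assumed of the curves: for small \<open>t\<close> definability provides
  their derivatives, and the limit of \<open>v\<close>.\<close>

lemma no_curve_of_oblique_normals:
  fixes x y v w :: "real \<Rightarrow> 'a::euclidean_space"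
  assumes dm: "dmap x" "dmap y" "dmap v" "dmap w"
    and "0 < \<epsilon>" "0 < C"
    and mem: "\<And>t. 0 < t \<Longrightarrow> x t \<in> X" "\<And>t. 0 < t \<Longrightarrow> y t \<in> Y"
    and v: "\<And>t. 0 < t \<Longrightarrow> v t \<in> frechet_normal_cone X (x t)" "\<And>t. 0 < t \<Longrightarrow> norm (v t) = 1"
    and w: "\<And>t. 0 < t \<Longrightarrow> w t \<in> frechet_normal_cone Y (y t)"
      "\<And>t. 0 < t \<Longrightarrow> norm (v t - w t) \<le> C * norm (y t - x t)"
    and bad: "\<And>t. 0 < t \<Longrightarrow> \<epsilon> * norm (y t - x t) < \<bar>v t \<bullet> (y t - x t)\<bar>"
    and small: "\<And>t. 0 < t \<Longrightarrow> norm (y t - x t) < t"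
    and bounded: "\<And>t. 0 < t \<Longrightarrow> norm (y t) \<le> B"
  shows False
proof -
  define u where "u t = y t - x t" for t
  have du: "dmap u" unfolding u_def by (intro dmap_diff dm)
  have pos: "\<forall>\<^sub>F t::real in at_right 0. 0 < t" by (rule eventually_at_rightI[of 0 1]) simp_all
  have u_lim: "(u \<longlongrightarrow> 0) (at_right 0)"
  proof (rule Lim_null_comparison)
    show "\<forall>\<^sub>F t in at_right 0. norm (u t) \<le> t"
      using pos by (rule eventually_mono) (simp add: u_def less_imp_le[OF small])
  qed (rule tendsto_ident_at)
  have u_inner: "((\<lambda>t. u t \<bullet> c) \<longlongrightarrow> 0) (at_right 0)" for c
    using tendsto_inner[OF u_lim tendsto_const[of c]] by simp
  have "\<forall>\<^sub>F t in at_right 0. norm (v t) \<le> 1"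
    using pos by (rule eventually_mono) (simp add: v(2))
  from dmap_bounded_limit[OF dm(3) this]
  obtain v0 where v0: "(v \<longlongrightarrow> v0) (at_right 0)" ..
  have close: "\<forall>\<^sub>F t in at_right 0. norm (v t - v0) < r" if "0 < r" for r
    using tendstoD[OF v0 that] by (simp add: dist_norm)
  define \<phi> where "\<phi> t = u t \<bullet> v0" for t
  have d\<phi>: "dmap \<phi>" unfolding \<phi>_def by (intro dmap_inner_const du)
  \<comment> \<open>Half of \<open>\<epsilon>\<close> pays for replacing \<open>v t\<close> by its
    limit.\<close>
  have big: "\<forall>\<^sub>F t in at_right 0. \<epsilon> / 2 * norm (u t) < \<bar>\<phi> t\<bar>"
    using pos close[OF half_gt_zero[OF \<open>0 < \<epsilon>\<close>]]
  proof eventually_elim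
    case (elim t)
    have "\<bar>(v t - v0) \<bullet> u t\<bar> \<le> norm (v t - v0) * norm (u t)" by (rule Cauchy_Schwarz_ineq2)
    also have "\<dots> \<le> \<epsilon> / 2 * norm (u t)" using elim by (intro mult_right_mono) simp_all
    finally have "\<bar>(v t - v0) \<bullet> u t\<bar> \<le> \<epsilon> / 2 * norm (u t)" .
    moreover have "\<epsilon> * norm (u t) < \<bar>v t \<bullet> u t\<bar>" using bad[OF elim(1)] by (simp add: u_def)
    moreover have "(v t - v0) \<bullet> u t = v t \<bullet> u t - \<phi> t"
      by (simp add: \<phi>_def inner_diff_left inner_commute[of "u t" v0])
    ultimately show ?case by linarith
  qed
  \<comment> \<open>A constant sign replaces the absolute value, so that \<open>g\<close> below is a
    multiple of \<open>\<phi>\<close> and inherits its derivative.\<close>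
  obtain \<sigma> :: real where \<sigma>: "\<bar>\<sigma>\<bar> = 1" and sign: "\<forall>\<^sub>F t in at_right 0. \<bar>\<phi> t\<bar> = \<sigma> * \<phi> t"
  proof -
    have "dpred (\<lambda>t. 0 \<le> \<phi> t)" by (intro dpred_le dmap_const d\<phi>)
    then consider "\<forall>\<^sub>F t in at_right 0. 0 \<le> \<phi> t" | "\<forall>\<^sub>F t in at_right 0. \<not> 0 \<le> \<phi> t"
      using dpred_germ by blast
    then show thesis
    proof cases
      case 1
      then have "\<forall>\<^sub>F t in at_right 0. \<bar>\<phi> t\<bar> = 1 * \<phi> t" by (rule eventually_mono) simp
      then show thesis by (rule that[rotated]) simp
    next
      case 2
      then have "\<forall>\<^sub>F t in at_right 0. \<bar>\<phi> t\<bar> = - 1 * \<phi> t" by (rule eventually_mono) simp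
      then show thesis by (rule that[rotated]) simp
    qed
  qed
  define g where "g t = \<sigma> * \<phi> t" for t
  define K where "K = 2 / \<epsilon>"
  have "0 < K" using \<open>0 < \<epsilon>\<close> by (simp add: K_def)
  have dg: "dmap g" unfolding g_def by (intro dmap_mult dmap_const d\<phi>)
  have u_le: "\<forall>\<^sub>F t in at_right 0. 0 < g t \<and> norm (u t) \<le> K * g t"
    using big sign
  proof eventually_elim
    case (elim t)
    then have lt: "\<epsilon> / 2 * norm (u t) < g t" by (simp add: g_def)
    moreover have "0 \<le> \<epsilon> / 2 * norm (u t)" using \<open>0 < \<epsilon>\<close> by simp
    ultimately have "0 < g t" by linarith
    with lt show ?case using \<open>0 < \<epsilon>\<close> by (simp add: K_def field_simps)
  qed
  have g_lim: "(g \<longlongrightarrow> 0) (at_right 0)"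
    unfolding g_def \<phi>_def using tendsto_mult_right_zero[OF u_inner] by simp
  \<comment> \<open>Each coordinate of \<open>u\<close> is bounded by
    \<open>norm (u t) \<le> K * g t\<close>. Both signs \<open>\<tau>\<close> therefore give
    nonnegative germs with limit 0, and together they bound the coordinates of \<open>u'\<close> by
    \<open>K * g'\<close>.\<close>
  have deriv_le: "\<forall>\<^sub>F t in at_right 0. \<forall>b\<in>Basis. \<forall>l.
      ((\<lambda>t. K * g t + \<tau> * (u t \<bullet> b)) has_real_derivative l) (at t) \<longrightarrow> 0 \<le> l"
    if \<tau>: "\<bar>\<tau>\<bar> = 1" for \<tau>
  proof (intro eventually_ball_finite finite_Basis ballI eventually_deriv_nonneg)
    fix b :: 'a assume b: "b \<in> Basis"
    show "dmap (\<lambda>t. K * g t + \<tau> * (u t \<bullet> b))"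
      by (intro dmap_add dmap_mult dmap_const dg dmap_inner_const du)
    show "\<forall>\<^sub>F t in at_right 0. 0 \<le> K * g t + \<tau> * (u t \<bullet> b)"
      using u_le
    proof (rule eventually_mono)
      fix t assume "0 < g t \<and> norm (u t) \<le> K * g t"
      moreover have "\<bar>\<tau> * (u t \<bullet> b)\<bar> \<le> norm (u t)"
        using Basis_le_norm[OF b, of "u t"] \<tau> by (simp add: abs_mult)
      ultimately show "0 \<le> K * g t + \<tau> * (u t \<bullet> b)" by linarith
    qed
    show "((\<lambda>t. K * g t + \<tau> * (u t \<bullet> b)) \<longlongrightarrow> 0) (at_right 0)"
      by (intro tendsto_add_zero tendsto_mult_right_zero g_lim u_inner)
  qed
  have "\<forall>b. \<exists>s. \<bar>s\<bar> = 1 \<and> (\<forall>\<^sub>F t in at_right 0. \<forall>l.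
      ((\<lambda>t. y t \<bullet> b) has_real_derivative l) (at t) \<longrightarrow> \<bar>l\<bar> = s * l)"
    by (intro allI eventually_deriv_sign dmap_inner_const dm)
  from choice[OF this] obtain s where s: "\<And>b. \<bar>s b\<bar> = 1"
    and ysign: "\<And>b. \<forall>\<^sub>F t in at_right 0. \<forall>l.
      ((\<lambda>t. y t \<bullet> b) has_real_derivative l) (at t) \<longrightarrow> \<bar>l\<bar> = s b * l"
    by blast
  have ysign': "\<forall>\<^sub>F t in at_right 0. \<forall>b\<in>Basis. \<forall>l. ((\<lambda>t. y t \<bullet> b) has_real_derivative l) (at t) \<longrightarrow> \<bar>l\<bar> = s b * l"
    by (intro eventually_ball_finite finite_Basis ballI ysign)
  \<comment> \<open>A substitute for arc length: near 0 its derivative is the sum of the absolute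
    coordinates of \<open>y'\<close>, which dominates \<open>norm y'\<close>, while \<open>L\<close>
    itself is bounded because \<open>y\<close> is.\<close>
  define L where "L t = (\<Sum>b\<in>Basis. s b * (y t \<bullet> b))" for t
  define n where "n = real DIM('a)"
  have "0 < n" by (simp add: n_def)
  show False
  proof (rule log_growth_contradiction[where g = g and L = L and K = "2 * C * K" and B = "n * B"])
    show "\<forall>\<^sub>F t in at_right 0. 0 < g t" using u_le by (rule eventually_mono) simp
    show "(g \<longlongrightarrow> 0) (at_right 0)" by (rule g_lim)
    show "\<forall>\<^sub>F t in at_right 0. \<bar>L t\<bar> \<le> n * B"
      using pos
    proof (rule eventually_mono)
      fix t :: real assume t: "0 < t"
      have "\<bar>L t\<bar> \<le> (\<Sum>b\<in>Basis. \<bar>s b * (y t \<bullet> b)\<bar>)" unfolding L_def by (rule sum_abs)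
      also have "\<dots> \<le> (\<Sum>b\<in>(Basis :: 'a set). B)"
      proof (rule sum_mono)
        fix b :: 'a assume "b \<in> Basis"
        then show "\<bar>s b * (y t \<bullet> b)\<bar> \<le> B"
          using Basis_le_norm[of b "y t"] bounded[OF t] s[of b] by (simp add: abs_mult)
      qed
      finally show "\<bar>L t\<bar> \<le> n * B" by (simp add: n_def)
    qed
    \<comment> \<open>Summing over the \<open>n\<close> coordinates will give
      \<open>norm u' \<le> n * (K * g')\<close>; this threshold then keeps the error
      \<open>(v t - v0) \<bullet> u'\<close> below \<open>g' / 2\<close>.\<close>
    have "\<forall>\<^sub>F t in at_right 0. norm (v t - v0) < 1 / (2 * n * K)"
      using \<open>0 < n\<close> \<open>0 < K\<close> by (intro close) simp
    with pos eventually_vector_differentiable[OF dm(1)] eventually_vector_differentiable[OF dm(2)]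
      u_le deriv_le[of 1, simplified] deriv_le[of "-1", simplified] ysign'
    show "\<forall>\<^sub>F t in at_right 0. \<exists>g' L'. (g has_real_derivative g') (at t) \<and>
      (L has_real_derivative L') (at t) \<and> g' \<le> 2 * C * K * g t * L'"
    proof eventually_elim
      case (elim t)
      obtain lx ly where lx: "(x has_vector_derivative lx) (at t)" and ly: "(y has_vector_derivative ly) (at t)"
        using elim(2,3) by blast
      define lu where "lu = ly - lx"
      have lu: "(u has_vector_derivative lu) (at t)"
        unfolding u_def lu_def by (intro has_vector_derivative_diff lx ly)
      define g' where "g' = \<sigma> * (lu \<bullet> v0)"
      have g': "(g has_real_derivative g') (at t)"
        unfolding g_def \<phi>_def g'_def by (intro DERIV_cmult has_real_derivative_inner_right lu)
      have L': "(L has_real_derivative (\<Sum>b\<in>Basis. s b * (ly \<bullet> b))) (at t)"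
        unfolding L_def by (intro DERIV_sum DERIV_cmult has_real_derivative_inner_right ly)
      have L'_eq: "(\<Sum>b\<in>Basis. s b * (ly \<bullet> b)) = (\<Sum>b\<in>Basis. \<bar>ly \<bullet> b\<bar>)"
        using elim(7) has_real_derivative_inner_right[OF ly] by (intro sum.cong refl) (simp only:)
      have "\<bar>lu \<bullet> b\<bar> \<le> K * g'" if b: "b \<in> Basis" for b
      proof -
        have "((\<lambda>t. K * g t + u t \<bullet> b) has_real_derivative K * g' + lu \<bullet> b) (at t)"
          "((\<lambda>t. K * g t - u t \<bullet> b) has_real_derivative K * g' - lu \<bullet> b) (at t)"
          by (intro DERIV_add DERIV_diff DERIV_cmult g' has_real_derivative_inner_right lu)+
        then have "0 \<le> K * g' + lu \<bullet> b" "0 \<le> K * g' - lu \<bullet> b"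
          using elim(5,6) b by blast+
        then show ?thesis by linarith
      qed
      then have "(\<Sum>b\<in>Basis. \<bar>lu \<bullet> b\<bar>) \<le> (\<Sum>b\<in>(Basis :: 'a set). K * g')"
        by (rule sum_mono)
      with norm_le_l1[of lu] have lu_le: "norm lu \<le> n * (K * g')" by (simp add: n_def)
      have ev: "\<forall>\<^sub>F r in at t. 0 < r" using order_tendstoD(1)[OF tendsto_ident_at elim(1)] .
      have "v t \<bullet> lx = 0"
        by (rule frechet_normal_orthogonal_velocity[OF v(1)[OF elim(1)] eventually_mono[OF ev mem(1)] lx])
      moreover have "w t \<bullet> ly = 0"
        by (rule frechet_normal_orthogonal_velocity[OF w(1)[OF elim(1)] eventually_mono[OF ev mem(2)] ly])
      ultimately have "v t \<bullet> lu = (v t - w t) \<bullet> ly"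
        by (simp add: lu_def inner_diff_left inner_diff_right)
      then have "\<bar>v t \<bullet> lu\<bar> \<le> norm (v t - w t) * norm ly"
        by (simp only: Cauchy_Schwarz_ineq2)
      also have "\<dots> \<le> C * (K * g t) * norm ly"
      proof (rule mult_right_mono)
        have "norm (v t - w t) \<le> C * norm (u t)" using w(2)[OF elim(1)] by (simp add: u_def)
        also have "\<dots> \<le> C * (K * g t)" using elim(4) \<open>0 < C\<close> by simp
        finally show "norm (v t - w t) \<le> C * (K * g t)" .
      qed simp
      finally have vlu: "\<bar>v t \<bullet> lu\<bar> \<le> C * (K * g t) * norm ly" .
      have "\<bar>(v t - v0) \<bullet> lu\<bar> \<le> norm (v t - v0) * norm lu" by (rule Cauchy_Schwarz_ineq2)
      also have "\<dots> \<le> 1 / (2 * n * K) * (n * (K * g'))"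
        using elim(8) lu_le \<open>0 < n\<close> \<open>0 < K\<close> by (intro mult_mono) simp_all
      also have "\<dots> = g' / 2" using \<open>0 < n\<close> \<open>0 < K\<close> by simp
      finally have "\<bar>(v t - v0) \<bullet> lu\<bar> \<le> g' / 2" .
      moreover have "lu \<bullet> v0 = v t \<bullet> lu - (v t - v0) \<bullet> lu"
        by (simp add: inner_diff_left inner_commute[of lu v0])
      moreover have "g' \<le> \<bar>lu \<bullet> v0\<bar>"
        unfolding g'_def using abs_ge_self[of "\<sigma> * (lu \<bullet> v0)"] \<sigma> by (simp add: abs_mult)
      \<comment> \<open>Half of \<open>g'\<close> is absorbed on the left, whence the factor 2 in
        the growth constant.\<close>
      ultimately have "g' \<le> 2 * (C * (K * g t) * norm ly)" using vlu by linarith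
      also have "\<dots> \<le> 2 * (C * (K * g t) * (\<Sum>b\<in>Basis. \<bar>ly \<bullet> b\<bar>))"
        using elim(4) \<open>0 < C\<close> \<open>0 < K\<close> norm_le_l1[of ly] by (intro mult_left_mono) simp_all
      finally have "g' \<le> 2 * C * K * g t * (\<Sum>b\<in>Basis. s b * (ly \<bullet> b))"
        by (simp add: L'_eq mult.assoc)
      with g' L' show ?case by blast
    qed
  qed
qed

text \<open>
  A limiting normal \<open>w\<close> to \<open>Y\<close> close to \<open>v\<close> is traded for a Frechet normal by moving \<open>y\<close> within \<open>Y\<close>,
  which preserves the strict inequalities.
\<close>

theorem b_eq_regular_of_strongly_a_regular:
  fixes X Y :: "'a::euclidean_space set"
  assumes X: "definable D X" and Y: "definable D Y"
    and bX: "bounded X" and bY: "bounded Y" and reg: "strongly_a_regular X Y"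
  shows "b_eq_regular X Y"
proof (rule ccontr)
  assume "\<not> b_eq_regular X Y"
  then obtain \<epsilon> where "0 < \<epsilon>" and \<epsilon>: "\<And>t. 0 < t \<Longrightarrow> \<exists>x\<in>X. \<exists>y\<in>Y. \<exists>v\<in>limiting_normal_cone X x \<inter> cball 0 1.
      norm (y - x) < t \<and> \<not> \<bar>v \<bullet> (y - x)\<bar> \<le> \<epsilon> * norm (y - x)"
    unfolding b_eq_regular_def by meson
  obtain C where "0 < C" and C: "\<And>x y. x \<in> X \<Longrightarrow> y \<in> Y \<Longrightarrow>
      cone_gap (limiting_normal_cone X x) (limiting_normal_cone Y y) \<le> C * norm (x - y)"
    using reg unfolding strongly_a_regular_def by blast
  obtain B1 where B1: "\<And>x. x \<in> X \<Longrightarrow> norm x \<le> B1" using bX unfolding bounded_iff by blast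
  obtain B2 where B2: "\<And>y. y \<in> Y \<Longrightarrow> norm y \<le> B2" using bY unfolding bounded_iff by blast
  \<comment> \<open>The counterexamples at scale \<open>t\<close>, with Frechet normals and
    \<open>v\<close> of norm 1. The factor 2 before \<open>C\<close> is the slack needed to reach
    such normals from limiting ones.\<close>
  define A where "A t q \<longleftrightarrow> (let x = fst q; y = fst (snd q); v = fst (snd (snd q)); w = snd (snd (snd q)) in
      x \<in> X \<and> y \<in> Y \<and> v \<in> frechet_normal_cone X x \<and> w \<in> frechet_normal_cone Y y \<and> norm v = 1 \<and>
      norm (v - w) \<le> 2 * C * norm (y - x) \<and> \<epsilon> * norm (y - x) < \<bar>v \<bullet> (y - x)\<bar> \<and> norm (y - x) < t)"
    for t :: real and q :: "'a \<times> 'a \<times> 'a \<times> 'a"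
  have "\<exists>\<gamma>. dmap \<gamma> \<and> (\<forall>t>0. A t (\<gamma> t))"
  proof (rule definable_choice)
    show "dpred (\<lambda>z. A (fst z) (snd z))"
      unfolding A_def Let_def
      by (intro dpred_intros dpred_mem[OF X] dpred_mem[OF Y] dpred_frechet_normal_cone[OF X]
          dpred_frechet_normal_cone[OF Y] dmap_intros)
    \<comment> \<open>Choice requires bounded fibres; \<open>w\<close> is controlled only through
      its distance to the unit vector \<open>v\<close>.\<close>
    show "norm q \<le> B1 + (B2 + (1 + (1 + 2 * C * (B1 + B2))))" if "A t q" for t q
    proof -
      obtain x y v w where q: "q = (x, y, v, w)" by (rule prod_cases4)
      from that have h: "x \<in> X" "y \<in> Y" "norm v = 1" "norm (v - w) \<le> 2 * C * norm (y - x)"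
        by (simp_all add: A_def q)
      have "norm (y - x) \<le> B1 + B2"
        using norm_triangle_ineq4[of y x] B1[OF h(1)] B2[OF h(2)] by linarith
      then have "2 * C * norm (y - x) \<le> 2 * C * (B1 + B2)" using \<open>0 < C\<close> by simp
      moreover have "norm w \<le> norm v + norm (v - w)"
        using norm_triangle_ineq4[of v "v - w"] by simp
      moreover have "norm q \<le> norm x + (norm y + (norm v + norm w))"
        unfolding q using norm_Pair_le[of x "(y, v, w)"] norm_Pair_le[of y "(v, w)"] norm_Pair_le[of v w]
        by linarith
      ultimately show ?thesis using h B1[OF h(1)] B2[OF h(2)] by linarith
    qed
    fix t :: real assume "0 < t"
    then obtain x y v where "x \<in> X" and y: "y \<in> Y" and v: "v \<in> limiting_normal_cone X x"
      and vle: "norm v \<le> 1" and close: "norm (y - x) < t" and bad: "\<epsilon> * norm (y - x) < \<bar>v \<bullet> (y - x)\<bar>"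
      using \<epsilon>[of t] by (auto simp: not_le)
    have "0 \<le> \<epsilon> * norm (y - x)" using \<open>0 < \<epsilon>\<close> by simp
    with bad have "v \<noteq> 0" by auto
    obtain xs vs where xs: "\<And>i::nat. xs i \<in> X" and vs: "\<And>i. vs i \<in> frechet_normal_cone X (xs i)"
      and lim: "xs \<longlonglongrightarrow> x" "vs \<longlonglongrightarrow> v"
      using v unfolding limiting_normal_cone_def by blast
    \<comment> \<open>The limiting normal to \<open>X\<close> is replaced first, by moving
      \<open>x\<close>. The factor \<open>norm (vs i)\<close> makes the inequality homogeneous, so
      that it survives normalization; at the limit it stays strict because
      \<open>norm v \<le> 1\<close>.\<close>
    have "(\<lambda>i. \<bar>vs i \<bullet> (y - xs i)\<bar> - \<epsilon> * norm (vs i) * norm (y - xs i)) \<longlonglongrightarrow>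
        \<bar>v \<bullet> (y - x)\<bar> - \<epsilon> * norm v * norm (y - x)"
      by (intro tendsto_intros lim)
    moreover have "0 < \<bar>v \<bullet> (y - x)\<bar> - \<epsilon> * norm v * norm (y - x)"
    proof -
      have "\<epsilon> * norm v * norm (y - x) \<le> \<epsilon> * norm (y - x)"
        using vle \<open>0 < \<epsilon>\<close> by (intro mult_right_mono) simp_all
      with bad show ?thesis by simp
    qed
    ultimately have "\<forall>\<^sub>F i in sequentially. 0 < \<bar>vs i \<bullet> (y - xs i)\<bar> - \<epsilon> * norm (vs i) * norm (y - xs i)"
      by (rule order_tendstoD(1))
    moreover have "\<forall>\<^sub>F i in sequentially. norm (y - xs i) < t"
      using close by (intro order_tendstoD(2)[where y = "norm (y - x)"] tendsto_intros lim)
    moreover have "\<forall>\<^sub>F i in sequentially. vs i \<noteq> 0"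
      using tendsto_imp_eventually_ne[OF lim(2) \<open>v \<noteq> 0\<close>] .
    ultimately have "\<forall>\<^sub>F i in sequentially. 0 < \<bar>vs i \<bullet> (y - xs i)\<bar> - \<epsilon> * norm (vs i) * norm (y - xs i) \<and>
        norm (y - xs i) < t \<and> vs i \<noteq> 0"
      by (intro eventually_conj)
    then obtain i where i: "\<epsilon> * norm (vs i) * norm (y - xs i) < \<bar>vs i \<bullet> (y - xs i)\<bar>"
      "norm (y - xs i) < t" "vs i \<noteq> 0"
      by (auto dest: eventually_happens)
    define x' v' where "x' = xs i" and "v' = (1 / norm (vs i)) *\<^sub>R vs i"
    have x': "x' \<in> X" using xs by (simp add: x'_def)
    have v': "v' \<in> frechet_normal_cone X x'" "norm v' = 1"
      unfolding x'_def v'_def using frechet_normal_cone_scaleR[OF vs, of "1 / norm (vs i)" i] i(3)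
      by simp_all
    have bad': "\<epsilon> * norm (y - x') < \<bar>v' \<bullet> (y - x')\<bar>"
    proof -
      have "\<bar>v' \<bullet> (y - x')\<bar> = \<bar>vs i \<bullet> (y - xs i)\<bar> / norm (vs i)"
        by (simp add: x'_def v'_def abs_mult)
      with i(1,3) show ?thesis by (simp add: x'_def less_divide_eq mult_ac)
    qed
    have "0 < norm (y - x')"
      using bad' by (cases "y = x'") simp_all
    have "v' \<in> limiting_normal_cone X x'"
      unfolding limiting_normal_cone_def mem_Collect_eq
      using x' v' by (intro exI[of _ "\<lambda>_. x'"] exI[of _ "\<lambda>_. v'"]) simp
    then have "infdist v' (limiting_normal_cone Y y) \<le> cone_gap (limiting_normal_cone X x') (limiting_normal_cone Y y)"
      by (rule infdist_le_cone_gap[OF _ v'(2) zero_in_limiting_normal_cone[OF y]])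
    also have "\<dots> \<le> C * norm (y - x')" using C[OF x' y] by (simp add: norm_minus_commute)
    \<comment> \<open>Strictness yields an actual \<open>w\<close> below the bound without asking
      whether the infimum is attained, and leaves room for moving \<open>y\<close>
      afterwards.\<close>
    also have "\<dots> < 2 * C * norm (y - x')" using \<open>0 < C\<close> \<open>0 < norm (y - x')\<close> by simp
    finally have inf: "infdist v' (limiting_normal_cone Y y) < 2 * C * norm (y - x')" .
    have ne: "limiting_normal_cone Y y \<noteq> {}" using zero_in_limiting_normal_cone[OF y] by blast
    obtain w where w: "w \<in> limiting_normal_cone Y y" "dist v' w < 2 * C * norm (y - x')"
      using inf unfolding infdist_notempty[OF ne]
      by (subst (asm) cINF_less_iff) (use ne in auto)
    obtain ys ws where ys: "\<And>i::nat. ys i \<in> Y" and ws: "\<And>i. ws i \<in> frechet_normal_cone Y (ys i)"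
      and lim': "ys \<longlonglongrightarrow> y" "ws \<longlonglongrightarrow> w"
      using w(1) unfolding limiting_normal_cone_def by blast
    have "(\<lambda>i. \<bar>v' \<bullet> (ys i - x')\<bar> - \<epsilon> * norm (ys i - x')) \<longlonglongrightarrow> \<bar>v' \<bullet> (y - x')\<bar> - \<epsilon> * norm (y - x')"
      "(\<lambda>i. 2 * C * norm (ys i - x') - norm (v' - ws i)) \<longlonglongrightarrow> 2 * C * norm (y - x') - norm (v' - w)"
      "(\<lambda>i. t - norm (ys i - x')) \<longlonglongrightarrow> t - norm (y - x')"
      by (intro tendsto_intros lim')+
    moreover have "0 < \<bar>v' \<bullet> (y - x')\<bar> - \<epsilon> * norm (y - x')" "0 < 2 * C * norm (y - x') - norm (v' - w)"
      "0 < t - norm (y - x')"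
      using bad' w(2) i(2) by (simp_all add: dist_norm x'_def)
    ultimately have "\<forall>\<^sub>F i in sequentially. 0 < \<bar>v' \<bullet> (ys i - x')\<bar> - \<epsilon> * norm (ys i - x') \<and>
        0 < 2 * C * norm (ys i - x') - norm (v' - ws i) \<and> 0 < t - norm (ys i - x')"
      by (intro eventually_conj order_tendstoD(1))
    then obtain j where "0 < \<bar>v' \<bullet> (ys j - x')\<bar> - \<epsilon> * norm (ys j - x')"
        "0 < 2 * C * norm (ys j - x') - norm (v' - ws j)" "0 < t - norm (ys j - x')"
      by (auto dest: eventually_happens)
    then have "A t (x', ys j, v', ws j)"
      using x' v' ys ws by (simp add: A_def)
    then show "\<exists>q. A t q" ..
  qed
  then obtain \<gamma> where d\<gamma>: "dmap \<gamma>" and \<gamma>: "\<And>t. 0 < t \<Longrightarrow> A t (\<gamma> t)" by blast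
  show False
    by (rule no_curve_of_oblique_normals[where x = "\<lambda>t. fst (\<gamma> t)" and y = "\<lambda>t. fst (snd (\<gamma> t))" and
        v = "\<lambda>t. fst (snd (snd (\<gamma> t)))" and w = "\<lambda>t. snd (snd (snd (\<gamma> t)))" and
        X = X and Y = Y and C = "2 * C" and \<epsilon> = \<epsilon> and B = B2])
      (use \<gamma> \<open>0 < C\<close> \<open>0 < \<epsilon>\<close> B2 in \<open>simp_all add: A_def Let_def dmap_fst dmap_snd d\<gamma>\<close>)
qed

lemma definable_Int_ball:
  assumes "definable D X"
  shows "definable D (X \<inter> ball a r)"
proof -
  have "dpred (\<lambda>x. x \<in> X \<and> norm (a - x) < r)"
    by (intro dpred_conj dpred_mem[OF assms] dpred_less dmap_intros)
  moreover have "X \<inter> ball a r = {x. x \<in> X \<and> norm (a - x) < r}" by (auto simp: dist_norm)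
  ultimately show ?thesis by (simp add: dpred_def)
qed

end

lemma strongly_a_regular_Int_open:
  assumes "strongly_a_regular (X \<inter> U) (Y \<inter> U)" "open U" "open V" "V \<subseteq> U"
  shows "strongly_a_regular (X \<inter> V) (Y \<inter> V)"
proof -
  obtain C where C: "C > 0" "\<And>x y. x \<in> X \<inter> U \<Longrightarrow> y \<in> Y \<inter> U \<Longrightarrow>
      cone_gap (limiting_normal_cone (X \<inter> U) x) (limiting_normal_cone (Y \<inter> U) y) \<le> C * norm (x - y)"
    using assms(1) unfolding strongly_a_regular_def by blast
  have "cone_gap (limiting_normal_cone (X \<inter> V) x) (limiting_normal_cone (Y \<inter> V) y) \<le> C * norm (x - y)"
    if "x \<in> X \<inter> V" "y \<in> Y \<inter> V" for x y
  proof -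
    have "x \<in> V" "y \<in> V" "x \<in> U" "y \<in> U" "x \<in> X \<inter> U" "y \<in> Y \<inter> U" using that assms(4) by auto
    then show ?thesis
      using C(2)[of x y] assms(2,3) by (simp add: limiting_normal_cone_Int_open)
  qed
  with C(1) show ?thesis unfolding strongly_a_regular_def by blast
qed

theorem theorem3p11:
  fixes X Y :: "'a::euclidean_space set" and a :: 'a
    and D :: "nat \<Rightarrow> real list set set"
  assumes "o_minimal_structure D"
    and "definable D X" and "definable D Y"
    and "a \<in> Y"
    and "C2_manifold_around Y a"
    and "locally closed X"
    and "near strongly_a_regular X Y a"
  shows "near b_eq_regular X Y a"
proof -
  interpret o_minimal_structure D by fact
  obtain U where U: "open U" "a \<in> U" "strongly_a_regular (X \<inter> U) (Y \<inter> U)"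
    using assms(7) unfolding near_def by blast
  \<comment> \<open>The given neighbourhood may be neither definable nor bounded; a ball inside it
    is both.\<close>
  obtain r where r: "0 < r" "ball a r \<subseteq> U"
    using U(1,2) open_contains_ball by blast
  have "strongly_a_regular (X \<inter> ball a r) (Y \<inter> ball a r)"
    by (rule strongly_a_regular_Int_open[OF U(3,1) open_ball r(2)])
  then have "b_eq_regular (X \<inter> ball a r) (Y \<inter> ball a r)"
    by (intro b_eq_regular_of_strongly_a_regular definable_Int_ball assms(2,3))
      (simp_all add: bounded_Int)
  then show ?thesis
    unfolding near_def using r(1) by (intro exI[of _ "ball a r"]) simp
qed

end
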